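(* Let $R$ be a graded ring supported in non-negative degrees and let $M$ be a Gröbner-coherent graded $R$-module. Then $M$ is coherent as an (ungraded) $R$-module.
   Context: Rings are commutative with unit; gradings are by $\mathbb{Z}$; graded modules $M$ are assumed to satisfy $M_n=0$ for $n\ll 0$. For a nonzero $x=\sum_n x_n\in M$ with $x_n\in M_n$, $\deg(x)$ is the maximal $n$ with $x_n\ne 0$ and $\mathrm{in}(x)=x_{\deg(x)}$; set $\deg(0)=-\infty$, $\mathrm{in}(0)=0$. For a (not necessarily homogeneous) submodule $N\subset M$, $\mathrm{in}(N)$ is the homogeneous submodule generated by $\mathrm{in}(x)$ over all nonzero $x\in N$. A Gröbner basis for $N$ is a collection of elements of $N$ whose initial terms generate $\mathrm{in}(N)$ as an $R$-module. A module is coherent if it is finitely generated and every finitely generated submodule is finitely presented (ignoring any grading). A graded module is graded-coherent if it is finitely generated and every finitely generated homogeneous submodule is finitely presented. A graded module $M$ is Gröbner-coherent if it is graded-coherent and every finitely generated, not necessarily homogeneous, submodule of $M$ admits a finite Gröbner basis. *)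

theory Defs
  imports "HOL-Algebra.Module" "HOL-Algebra.AbelCoset" "HOL.Hull"
begin

section \<open>Finitely presented and coherent modules\<close>

text \<open>
  A submodule \<open>N\<close> of \<open>M\<close> is regarded as a module in its own right as \<open>M\<lparr>carrier := N\<rparr>\<close>.
\<close>

definition module_span ::
  "('r, 'a) ring_scheme \<Rightarrow> ('r, 'm, 'b) module_scheme \<Rightarrow> 'm set \<Rightarrow> 'm set"
  where "module_span R M S = (\<lambda>N. submodule N R M) hull S"

definition fin_gen :: "('r, 'a) ring_scheme \<Rightarrow> ('r, 'm, 'b) module_scheme \<Rightarrow> bool"
  where "fin_gen R M \<longleftrightarrow>
    (\<exists>S. finite S \<and> S \<subseteq> carrier M \<and> module_span R M S = carrier M)"

definition module_homs ::
  "('r, 'a) ring_scheme \<Rightarrow> ('r, 'm, 'b) module_scheme \<Rightarrow> ('r, 'n, 'c) module_scheme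
    \<Rightarrow> ('m \<Rightarrow> 'n) set"
  where "module_homs R M N =
    {f \<in> hom (add_monoid M) (add_monoid N).
      \<forall>a \<in> carrier R. \<forall>x \<in> carrier M. f (a \<odot>\<^bsub>M\<^esub> x) = a \<odot>\<^bsub>N\<^esub> f x}"

text \<open>
  The free module \<open>R\<^sup>n\<close>. The multiplicative fields, which the record type requires, play no
  role in the module structure.
\<close>

definition free_module :: "('r, 'a) ring_scheme \<Rightarrow> nat \<Rightarrow> ('r, nat \<Rightarrow> 'r) module"
  where "free_module R n =
    \<lparr>carrier = {..<n} \<rightarrow>\<^sub>E carrier R,
     mult = (\<lambda>v w. \<lambda>i\<in>{..<n}. v i \<otimes>\<^bsub>R\<^esub> w i),
     one = (\<lambda>i\<in>{..<n}. \<one>\<^bsub>R\<^esub>),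
     zero = (\<lambda>i\<in>{..<n}. \<zero>\<^bsub>R\<^esub>),
     add = (\<lambda>v w. \<lambda>i\<in>{..<n}. v i \<oplus>\<^bsub>R\<^esub> w i),
     smult = (\<lambda>a v. \<lambda>i\<in>{..<n}. a \<otimes>\<^bsub>R\<^esub> v i)\<rparr>"

definition fin_presented :: "('r, 'a) ring_scheme \<Rightarrow> ('r, 'm, 'b) module_scheme \<Rightarrow> bool"
  where "fin_presented R M \<longleftrightarrow>
    (\<exists>n. \<exists>f \<in> module_homs R (free_module R n) M.
      f ` carrier (free_module R n) = carrier M \<and>
      fin_gen R ((free_module R n)\<lparr>carrier := a_kernel (free_module R n) M f\<rparr>))"

definition coherent_module :: "('r, 'a) ring_scheme \<Rightarrow> ('r, 'm, 'b) module_scheme \<Rightarrow> bool"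
  where "coherent_module R M \<longleftrightarrow>
    fin_gen R M \<and>
    (\<forall>N. submodule N R M \<and> fin_gen R (M\<lparr>carrier := N\<rparr>)
          \<longrightarrow> fin_presented R (M\<lparr>carrier := N\<rparr>))"


section \<open>Gradings\<close>

text \<open>
  \<open>G\<close> is a family of subgroups of the additive group of \<open>A\<close> whose internal direct sum is \<open>A\<close>.
  A decomposition is a finitely supported family of elements \<open>f n \<in> G n\<close>.
\<close>

definition is_decomp ::
  "('m, 'b) ring_scheme \<Rightarrow> (int \<Rightarrow> 'm set) \<Rightarrow> 'm \<Rightarrow> (int \<Rightarrow> 'm) \<Rightarrow> bool"
  where "is_decomp A G x f \<longleftrightarrow>
    (\<forall>n. f n \<in> G n) \<and> finite {n. f n \<noteq> \<zero>\<^bsub>A\<^esub>} \<and> x = finsum A f {n. f n \<noteq> \<zero>\<^bsub>A\<^esub>}"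

definition grading :: "('m, 'b) ring_scheme \<Rightarrow> (int \<Rightarrow> 'm set) \<Rightarrow> bool"
  where "grading A G \<longleftrightarrow>
    (\<forall>n. subgroup (G n) (add_monoid A)) \<and> (\<forall>x \<in> carrier A. \<exists>!f. is_decomp A G x f)"

definition component :: "('m, 'b) ring_scheme \<Rightarrow> (int \<Rightarrow> 'm set) \<Rightarrow> 'm \<Rightarrow> int \<Rightarrow> 'm"
  where "component A G x = (THE f. is_decomp A G x f)"

locale graded_ring = cring R
  for R :: "('r, 'a) ring_scheme" (structure) and RG :: "int \<Rightarrow> 'r set" +
  assumes ring_grading: "grading R RG"
    and graded_mult: "a \<in> RG i \<Longrightarrow> b \<in> RG j \<Longrightarrow> a \<otimes> b \<in> RG (i + j)"

locale graded_module = graded_ring R RG + module R M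
  for R :: "('r, 'a) ring_scheme" (structure) and RG :: "int \<Rightarrow> 'r set"
    and M :: "('r, 'm, 'b) module_scheme" (structure) and MG :: "int \<Rightarrow> 'm set" +
  assumes module_grading: "grading M MG"
    and graded_smult: "a \<in> RG i \<Longrightarrow> x \<in> MG j \<Longrightarrow> a \<odot>\<^bsub>M\<^esub> x \<in> MG (i + j)"
    and bounded_below: "\<exists>n0. \<forall>n < n0. MG n = {\<zero>\<^bsub>M\<^esub>}"

definition homogeneous_submodule ::
  "('r, 'a) ring_scheme \<Rightarrow> ('r, 'm, 'b) module_scheme \<Rightarrow> (int \<Rightarrow> 'm set) \<Rightarrow> 'm set \<Rightarrow> bool"
  where "homogeneous_submodule R M MG N \<longleftrightarrow>
    submodule N R M \<and> (\<forall>x \<in> N. \<forall>n. component M MG x n \<in> N)"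

definition graded_coherent ::
  "('r, 'a) ring_scheme \<Rightarrow> ('r, 'm, 'b) module_scheme \<Rightarrow> (int \<Rightarrow> 'm set) \<Rightarrow> bool"
  where "graded_coherent R M MG \<longleftrightarrow>
    fin_gen R M \<and>
    (\<forall>N. homogeneous_submodule R M MG N \<and> fin_gen R (M\<lparr>carrier := N\<rparr>)
          \<longrightarrow> fin_presented R (M\<lparr>carrier := N\<rparr>))"


section \<open>Initial terms and Groebner bases\<close>

text \<open>The degree is meaningful only for nonzero elements; the degree of zero is never used.\<close>

definition deg_of :: "('r, 'm, 'b) module_scheme \<Rightarrow> (int \<Rightarrow> 'm set) \<Rightarrow> 'm \<Rightarrow> int"
  where "deg_of M MG x = Max {n. component M MG x n \<noteq> \<zero>\<^bsub>M\<^esub>}"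

definition initial_term :: "('r, 'm, 'b) module_scheme \<Rightarrow> (int \<Rightarrow> 'm set) \<Rightarrow> 'm \<Rightarrow> 'm"
  where "initial_term M MG x =
    (if x = \<zero>\<^bsub>M\<^esub> then \<zero>\<^bsub>M\<^esub> else component M MG x (deg_of M MG x))"

definition initial_submodule ::
  "('r, 'a) ring_scheme \<Rightarrow> ('r, 'm, 'b) module_scheme \<Rightarrow> (int \<Rightarrow> 'm set) \<Rightarrow> 'm set \<Rightarrow> 'm set"
  where "initial_submodule R M MG N =
    module_span R M (initial_term M MG ` (N - {\<zero>\<^bsub>M\<^esub>}))"

definition groebner_basis ::
  "('r, 'a) ring_scheme \<Rightarrow> ('r, 'm, 'b) module_scheme \<Rightarrow> (int \<Rightarrow> 'm set) \<Rightarrow> 'm set \<Rightarrow> 'm set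
    \<Rightarrow> bool"
  where "groebner_basis R M MG N B \<longleftrightarrow>
    B \<subseteq> N \<and> module_span R M (initial_term M MG ` B) = initial_submodule R M MG N"

definition groebner_coherent ::
  "('r, 'a) ring_scheme \<Rightarrow> ('r, 'm, 'b) module_scheme \<Rightarrow> (int \<Rightarrow> 'm set) \<Rightarrow> bool"
  where "groebner_coherent R M MG \<longleftrightarrow>
    graded_coherent R M MG \<and>
    (\<forall>N. submodule N R M \<and> fin_gen R (M\<lparr>carrier := N\<rparr>)
          \<longrightarrow> (\<exists>B. finite B \<and> groebner_basis R M MG N B))"

end

theory Submission
  imports Defs
begin

text \<open>
  Let \<open>b\<^sub>j\<close> be a finite Groebner basis of a finitely generated submodule \<open>N\<close>, and grade the free module
  on generators \<open>e\<^sub>j\<close> by placing \<open>e\<^sub>j\<close> in degree \<open>deg b\<^sub>j\<close>. The maps \<open>\<phi>\<close> and \<open>\<psi>\<close> sending \<open>e\<^sub>j\<close> to \<open>b\<^sub>j\<close>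
  and to its initial term differ by a map lowering degrees, so division by the Groebner basis
  terminates and \<open>\<phi>\<close> maps onto \<open>N\<close>. The image of \<open>\<psi>\<close> is the initial submodule of \<open>N\<close>, which is finitely
  presented by graded coherence, so by Schanuel's argument the kernel of \<open>\<psi>\<close> is generated by finitely
  many homogeneous relations. Each of them lifts, modulo lower degree, to a relation among the \<open>b\<^sub>j\<close>,
  and by descent on the degree the lifts generate the kernel of \<open>\<phi>\<close>.
\<close>

section \<open>Submodules, spans and linear maps\<close>

lemma (in abelian_group) eq_of_diff_eq_zero:
  assumes "x \<ominus> y = \<zero>" "x \<in> carrier G" "y \<in> carrier G"
  shows "x = y"
  using assms minus_equality[of x "\<ominus> y"] by (simp add: a_minus_def)

lemma (in abelian_group) diff_zero: "x \<in> carrier G \<Longrightarrow> x \<ominus> \<zero> = x"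
  using minus_equality[of \<zero> \<zero>] by (simp add: a_minus_def)

lemma (in abelian_group) diff_self: "x \<in> carrier G \<Longrightarrow> x \<ominus> x = \<zero>"
  by (simp add: a_minus_def r_neg)

lemma (in abelian_group) diff_add_diff:
  assumes "u \<in> carrier G" "v \<in> carrier G" "w \<in> carrier G" "z \<in> carrier G"
  shows "(u \<oplus> v) \<ominus> (w \<oplus> z) = (u \<ominus> w) \<oplus> (v \<ominus> z)"
  using assms by (simp add: a_minus_def minus_add a_ac)

lemma (in abelian_group) diff_add_cancel:
  "x \<in> carrier G \<Longrightarrow> y \<in> carrier G \<Longrightarrow> (x \<ominus> y) \<oplus> y = x"
  by (simp add: a_minus_def a_assoc l_neg)

lemma (in module) smult_diff:
  "a \<in> carrier R \<Longrightarrow> x \<in> carrier M \<Longrightarrow> y \<in> carrier M \<Longrightarrow>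
    a \<odot>\<^bsub>M\<^esub> (x \<ominus>\<^bsub>M\<^esub> y) = a \<odot>\<^bsub>M\<^esub> x \<ominus>\<^bsub>M\<^esub> a \<odot>\<^bsub>M\<^esub> y"
  by (simp add: a_minus_def smult_r_distr smult_r_minus)

section \<open>Submodules and their spans\<close>

lemma (in module) submodule_iff:
  "submodule H R M \<longleftrightarrow> H \<subseteq> carrier M \<and> \<zero>\<^bsub>M\<^esub> \<in> H \<and> (\<forall>x\<in>H. \<forall>y\<in>H. x \<oplus>\<^bsub>M\<^esub> y \<in> H) \<and>
    (\<forall>a\<in>carrier R. \<forall>x\<in>H. a \<odot>\<^bsub>M\<^esub> x \<in> H)" (is "?L \<longleftrightarrow> ?R")
proof
  assume L: ?L
  then interpret submodule H R M .
  show ?R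
    using subset one_closed m_closed smult_closed by auto
next
  assume r: ?R
  show ?L
  proof (rule submoduleI)
    \<comment> \<open>Closure under negation comes from scalar multiplication by minus one.\<close>
    fix a assume a: "a \<in> H"
    have "\<ominus>\<^bsub>M\<^esub> a = (\<ominus> \<one>) \<odot>\<^bsub>M\<^esub> a"
      using a r by (auto simp: smult_l_minus)
    also have "\<dots> \<in> H"
      using a r by auto
    finally show "\<ominus>\<^bsub>M\<^esub> a \<in> H" .
  qed (use r in auto)
qed

lemma (in module) submodule_minus:
  assumes "submodule H R M" "x \<in> H" "y \<in> H"
  shows "x \<ominus>\<^bsub>M\<^esub> y \<in> H"
  using submoduleE[OF assms(1)] assms(2,3) by (simp add: a_minus_def)

lemma (in module) submodule_restrict_iff:
  assumes "submodule K R M"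
  shows "submodule N R (M\<lparr>carrier := K\<rparr>) \<longleftrightarrow> submodule N R M \<and> N \<subseteq> K"
proof -
  interpret K: module R "M\<lparr>carrier := K\<rparr>"
    using submodule.submodule_is_module[OF assms] module_axioms by blast
  show ?thesis
    using assms unfolding K.submodule_iff submodule_iff by auto
qed

text \<open>The hull intersects all submodules containing \<open>S\<close>. The carrier is one of
  them, which keeps the intersection inside the carrier.\<close>

lemma (in module) span_submodule:
  assumes "S \<subseteq> carrier M"
  shows "submodule (module_span R M S) R M"
  using assms carrier_is_submodule
  unfolding module_span_def hull_def submodule_iff by blast

lemma span_superset: "S \<subseteq> module_span R M S"
  unfolding module_span_def by (rule hull_subset)

lemma span_least: "S \<subseteq> N \<Longrightarrow> submodule N R M \<Longrightarrow> module_span R M S \<subseteq> N"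
  unfolding module_span_def by (rule hull_minimal)

text \<open>Allows generators of a submodule to be tested in the ambient module, although
  \<open>fin_gen\<close> refers to the submodule as a module of its own.\<close>

lemma (in module) span_restrict:
  assumes "submodule K R M" "S \<subseteq> K"
  shows "module_span R (M\<lparr>carrier := K\<rparr>) S = module_span R M S"
proof -
  interpret K: module R "M\<lparr>carrier := K\<rparr>"
    using submodule.submodule_is_module[OF assms(1)] module_axioms by blast
  have "K \<subseteq> carrier M"
    using assms(1) by (simp add: submodule_iff)
  then have "S \<subseteq> carrier M"
    using assms(2) by blast
  then have "submodule (module_span R M S) R M" "module_span R M S \<subseteq> K"
    using span_submodule span_least assms by blast+
  moreover have "submodule (module_span R (M\<lparr>carrier := K\<rparr>) S) R M"
    using K.span_submodule[of S] assms submodule_restrict_iff by auto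
  ultimately show ?thesis
    by (intro equalityI span_least span_superset) (auto simp: submodule_restrict_iff assms)
qed

lemma (in module) fin_gen_submodule_iff:
  assumes "submodule K R M"
  shows "fin_gen R (M\<lparr>carrier := K\<rparr>) \<longleftrightarrow> (\<exists>S. finite S \<and> S \<subseteq> K \<and> module_span R M S = K)"
  unfolding fin_gen_def using span_restrict[OF assms] by auto

section \<open>Linear maps, their kernels and images\<close>

locale linear_map = M: module R M + N: module R N
  for R (structure) and M and N +
  fixes f
  assumes module_hom: "f \<in> module_homs R M N"
begin

lemma closed [simp]: "x \<in> carrier M \<Longrightarrow> f x \<in> carrier N"
  using module_hom by (auto simp: module_homs_def hom_def)

lemma add [simp]: "x \<in> carrier M \<Longrightarrow> y \<in> carrier M \<Longrightarrow> f (x \<oplus>\<^bsub>M\<^esub> y) = f x \<oplus>\<^bsub>N\<^esub> f y"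
  using module_hom by (auto simp: module_homs_def hom_def)

lemma smult [simp]: "a \<in> carrier R \<Longrightarrow> x \<in> carrier M \<Longrightarrow> f (a \<odot>\<^bsub>M\<^esub> x) = a \<odot>\<^bsub>N\<^esub> f x"
  using module_hom by (auto simp: module_homs_def)

lemma zero [simp]: "f \<zero>\<^bsub>M\<^esub> = \<zero>\<^bsub>N\<^esub>"
  using smult[of "\<zero>" "\<zero>\<^bsub>M\<^esub>"] by simp

lemma minus [simp]:
  assumes "x \<in> carrier M" "y \<in> carrier M"
  shows "f (x \<ominus>\<^bsub>M\<^esub> y) = f x \<ominus>\<^bsub>N\<^esub> f y"
proof -
  have "f (\<ominus>\<^bsub>M\<^esub> y) = \<ominus>\<^bsub>N\<^esub> f y"
    using assms smult[of "\<ominus> \<one>" y] by (simp add: M.smult_l_minus N.smult_l_minus)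
  then show ?thesis
    using assms by (simp add: a_minus_def)
qed

lemma vimage_submodule:
  "submodule K R N \<Longrightarrow> submodule {x \<in> carrier M. f x \<in> K} R M"
  by (auto simp: M.submodule_iff N.submodule_iff)

lemma kernel_submodule: "submodule (a_kernel M N f) R M"
  by (auto simp: M.submodule_iff a_kernel_def')

lemma image_submodule: "submodule (f ` carrier M) R N"
proof -
  have "f x \<oplus>\<^bsub>N\<^esub> f y \<in> f ` carrier M" if "x \<in> carrier M" "y \<in> carrier M" for x y
    using that by (metis M.M.a_closed add image_eqI)
  moreover have "a \<odot>\<^bsub>N\<^esub> f x \<in> f ` carrier M" if "a \<in> carrier R" "x \<in> carrier M" for a x
    using that by (metis M.smult_closed smult image_eqI)
  ultimately show ?thesis
    unfolding N.submodule_iff by (auto intro: rev_image_eqI[of "\<zero>\<^bsub>M\<^esub>"])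
qed

lemma image_span:
  assumes "module_span R M S = carrier M" "S \<subseteq> carrier M"
  shows "f ` carrier M = module_span R N (f ` S)"
proof (rule equalityI)
  have sub: "submodule (module_span R N (f ` S)) R N"
    using assms(2) by (intro N.span_submodule) auto
  have "module_span R M S \<subseteq> {x \<in> carrier M. f x \<in> module_span R N (f ` S)}"
    using assms(2) span_superset[of "f ` S" R N]
    by (intro span_least vimage_submodule sub) auto
  then show "f ` carrier M \<subseteq> module_span R N (f ` S)"
    using assms(1) by auto
  show "module_span R N (f ` S) \<subseteq> f ` carrier M"
    using assms(2) by (intro span_least image_submodule) auto
qed

lemma maps_into_submodule:
  assumes "module_span R M S = carrier M" "S \<subseteq> carrier M" "f ` S \<subseteq> K" "submodule K R N"
    and "x \<in> carrier M"
  shows "f x \<in> K"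
  using assms image_span[OF assms(1,2)] span_least[OF assms(3,4)] by blast

end

text \<open>The equalizer of two linear maps is a submodule, so it is everything once it contains a
  generating set.\<close>

lemma linear_map_eq_on_span:
  assumes f: "linear_map R M N f" and g: "linear_map R M N g"
    and S: "module_span R M S = carrier M" "S \<subseteq> carrier M"
    and eq: "\<And>x. x \<in> S \<Longrightarrow> f x = g x" and x: "x \<in> carrier M"
  shows "f x = g x"
proof -
  interpret f: linear_map R M N f by fact
  interpret g: linear_map R M N g by fact
  have "submodule {x \<in> carrier M. f x = g x} R M"
    by (simp add: f.M.submodule_iff)
  then have "module_span R M S \<subseteq> {x \<in> carrier M. f x = g x}"
    using S eq by (intro span_least) auto
  then show ?thesis
    using S(1) x by blast
qed

text \<open>A kernel involves the codomain only through its zero, so a presentation of a submodule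
  can be treated as a map into the ambient module.\<close>

lemma a_kernel_restrict: "a_kernel M (N\<lparr>carrier := K\<rparr>) f = a_kernel M N f"
  by (simp add: a_kernel_def')

lemma (in module) module_homs_restrict_iff:
  assumes "submodule N R M"
  shows "f \<in> module_homs R L (M\<lparr>carrier := N\<rparr>) \<longleftrightarrow>
    f \<in> module_homs R L M \<and> f ` carrier L \<subseteq> N"
proof -
  have "N \<subseteq> carrier M"
    using assms by (simp add: submodule_iff)
  then show ?thesis
    unfolding module_homs_def hom_def by (simp add: Pi_iff image_subset_iff) blast
qed

lemma linear_mapI:
  assumes "module R M" "module R N"
    and "\<And>x. x \<in> carrier M \<Longrightarrow> f x \<in> carrier N"
    and "\<And>x y. x \<in> carrier M \<Longrightarrow> y \<in> carrier M \<Longrightarrow> f (x \<oplus>\<^bsub>M\<^esub> y) = f x \<oplus>\<^bsub>N\<^esub> f y"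
    and "\<And>a x. a \<in> carrier R \<Longrightarrow> x \<in> carrier M \<Longrightarrow> f (a \<odot>\<^bsub>M\<^esub> x) = a \<odot>\<^bsub>N\<^esub> f x"
  shows "linear_map R M N f"
  using assms by (auto intro!: linear_map.intro linear_map_axioms.intro
      simp: module_homs_def hom_def)

lemma linear_map_diff:
  assumes "linear_map R M N f" "linear_map R M N g"
  shows "linear_map R M N (\<lambda>x. f x \<ominus>\<^bsub>N\<^esub> g x)"
proof -
  interpret f: linear_map R M N f by fact
  interpret g: linear_map R M N g by fact
  show ?thesis
    by (intro linear_mapI f.M.module_axioms f.N.module_axioms)
      (simp_all add: f.N.diff_add_diff f.N.smult_diff)
qed

lemma linear_map_comp:
  assumes "linear_map R L M f" "linear_map R M N g"
  shows "linear_map R L N (\<lambda>x. g (f x))"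
proof -
  interpret f: linear_map R L M f by fact
  interpret g: linear_map R M N g by fact
  show ?thesis
    by (intro linear_mapI f.M.module_axioms g.N.module_axioms) simp_all
qed

lemma linear_map_ident: "module R M \<Longrightarrow> linear_map R M M (\<lambda>x. x)"
  by (simp add: linear_mapI)


section \<open>Free modules\<close>

definition free_unit :: "('r, 'a) ring_scheme \<Rightarrow> nat \<Rightarrow> nat \<Rightarrow> nat \<Rightarrow> 'r"
  where "free_unit R n i = (\<lambda>j\<in>{..<n}. if j = i then \<one>\<^bsub>R\<^esub> else \<zero>\<^bsub>R\<^esub>)"

text \<open>The map out of the free module given by its universal property: the \<open>i\<close>-th
  unit vector goes to \<open>m i\<close>.\<close>

definition free_lift ::
  "('r, 'm, 'b) module_scheme \<Rightarrow> nat \<Rightarrow> (nat \<Rightarrow> 'm) \<Rightarrow> (nat \<Rightarrow> 'r) \<Rightarrow> 'm"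
  where "free_lift M n m v = (\<Oplus>\<^bsub>M\<^esub>i\<in>{..<n}. v i \<odot>\<^bsub>M\<^esub> m i)"

lemma free_module_simps:
  "carrier (free_module R n) = {..<n} \<rightarrow>\<^sub>E carrier R"
  "\<zero>\<^bsub>free_module R n\<^esub> = (\<lambda>i\<in>{..<n}. \<zero>\<^bsub>R\<^esub>)"
  "v \<oplus>\<^bsub>free_module R n\<^esub> w = (\<lambda>i\<in>{..<n}. v i \<oplus>\<^bsub>R\<^esub> w i)"
  "a \<odot>\<^bsub>free_module R n\<^esub> v = (\<lambda>i\<in>{..<n}. a \<otimes>\<^bsub>R\<^esub> v i)"
  by (simp_all add: free_module_def)

lemma (in cring) module_free_module: "module R (free_module R n)"
proof -
  have mem: "v i \<in> carrier R" if "v \<in> {..<n} \<rightarrow>\<^sub>E carrier R" "i < n" for v i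
    using that by auto
  \<comment> \<open>Elements of the free module are extensional, hence equal to their own
    restrictions; this reduces each module axiom to a single coordinate.\<close>
  have ext: "(\<lambda>i\<in>{..<n}. v i) = v" if "v \<in> {..<n} \<rightarrow>\<^sub>E carrier R" for v
    using that by (simp add: PiE_iff extensional_restrict)
  have "abelian_group (free_module R n)"
  proof (rule abelian_groupI, unfold free_module_simps)
    fix x assume x: "x \<in> {..<n} \<rightarrow>\<^sub>E carrier R"
    show "(\<lambda>i\<in>{..<n}. (\<lambda>i\<in>{..<n}. \<zero>) i \<oplus> x i) = x"
      by (subst (2) ext[OF x, symmetric], rule restrict_ext) (simp add: mem[OF x])
    show "\<exists>y\<in>{..<n} \<rightarrow>\<^sub>E carrier R. (\<lambda>i\<in>{..<n}. y i \<oplus> x i) = (\<lambda>i\<in>{..<n}. \<zero>)"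
      by (intro bexI[of _ "\<lambda>i\<in>{..<n}. \<ominus> x i"] restrict_ext) (auto simp: l_neg mem[OF x])
    fix y assume y: "y \<in> {..<n} \<rightarrow>\<^sub>E carrier R"
    show "(\<lambda>i\<in>{..<n}. x i \<oplus> y i) = (\<lambda>i\<in>{..<n}. y i \<oplus> x i)"
      by (rule restrict_ext) (simp add: mem[OF x] mem[OF y] a_comm)
    fix z assume z: "z \<in> {..<n} \<rightarrow>\<^sub>E carrier R"
    show "(\<lambda>i\<in>{..<n}. (\<lambda>i\<in>{..<n}. x i \<oplus> y i) i \<oplus> z i) =
        (\<lambda>i\<in>{..<n}. x i \<oplus> (\<lambda>i\<in>{..<n}. y i \<oplus> z i) i)"
      by (rule restrict_ext) (simp add: mem[OF x] mem[OF y] mem[OF z] a_assoc)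
  qed (auto simp: mem)
  then show ?thesis
  proof (rule moduleI[OF is_cring], unfold free_module_simps)
    fix x assume x: "x \<in> {..<n} \<rightarrow>\<^sub>E carrier R"
    show "(\<lambda>i\<in>{..<n}. \<one> \<otimes> x i) = x"
      by (subst (2) ext[OF x, symmetric], rule restrict_ext) (simp add: mem[OF x])
    fix a assume a: "a \<in> carrier R"
    show "(\<lambda>i\<in>{..<n}. (a \<oplus> b) \<otimes> x i) =
        (\<lambda>i\<in>{..<n}. (\<lambda>i\<in>{..<n}. a \<otimes> x i) i \<oplus> (\<lambda>i\<in>{..<n}. b \<otimes> x i) i)"
      and "(\<lambda>i\<in>{..<n}. a \<otimes> b \<otimes> x i) = (\<lambda>i\<in>{..<n}. a \<otimes> (\<lambda>i\<in>{..<n}. b \<otimes> x i) i)"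
      if b: "b \<in> carrier R" for b
      by (rule restrict_ext, simp add: mem[OF x] a b l_distr m_assoc)+
    fix y assume y: "y \<in> {..<n} \<rightarrow>\<^sub>E carrier R"
    show "(\<lambda>i\<in>{..<n}. a \<otimes> (\<lambda>i\<in>{..<n}. x i \<oplus> y i) i) =
        (\<lambda>i\<in>{..<n}. (\<lambda>i\<in>{..<n}. a \<otimes> x i) i \<oplus> (\<lambda>i\<in>{..<n}. a \<otimes> y i) i)"
      by (rule restrict_ext) (simp add: mem[OF x] mem[OF y] a r_distr)
  qed (auto simp: mem)
qed

lemma (in cring) free_unit_closed [simp]: "free_unit R n i \<in> carrier (free_module R n)"
  by (auto simp: free_unit_def free_module_def)

text \<open>Induction on a bound \<open>k\<close> for the support of \<open>v\<close>: the last
  coordinate is split off as a multiple of a unit vector, and the rest has smaller support.\<close>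

lemma (in cring) free_unit_span:
  "module_span R (free_module R n) (free_unit R n ` {..<n}) = carrier (free_module R n)"
proof -
  let ?F = "free_module R n" and ?E = "free_unit R n ` {..<n}"
  interpret F: module R ?F by (rule module_free_module)
  have sub: "submodule (module_span R ?F ?E) R ?F"
    by (rule F.span_submodule) auto
  have "v \<in> module_span R ?F ?E"
    if "v \<in> carrier ?F" "\<forall>j<n. k \<le> j \<longrightarrow> v j = \<zero>" "k \<le> n" for v k
    using that
  proof (induction k arbitrary: v)
    case 0
    then have "v = \<zero>\<^bsub>?F\<^esub>"
      by (auto simp: free_module_def PiE_iff extensional_def fun_eq_iff)
    then show ?case
      using sub by (simp add: F.submodule_iff)
  next
    case (Suc k)
    let ?w = "v(k := \<zero>)"
    have "v i = (?w \<oplus>\<^bsub>?F\<^esub> v k \<odot>\<^bsub>?F\<^esub> free_unit R n k) i" if "i < n" for i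
      using that Suc.prems by (auto simp: free_module_simps free_unit_def PiE_iff)
    moreover have "?w \<oplus>\<^bsub>?F\<^esub> v k \<odot>\<^bsub>?F\<^esub> free_unit R n k \<in> extensional {..<n}"
      by (simp add: free_module_simps)
    ultimately have "v = ?w \<oplus>\<^bsub>?F\<^esub> v k \<odot>\<^bsub>?F\<^esub> free_unit R n k"
      using Suc.prems by (intro extensionalityI[of _ "{..<n}"]) (auto simp: free_module_simps PiE_iff)
    moreover have "?w \<in> module_span R ?F ?E"
      using Suc.prems by (intro Suc.IH) (auto simp: free_module_def PiE_iff extensional_def)
    moreover have "free_unit R n k \<in> module_span R ?F ?E" "v k \<in> carrier R"
      using Suc.prems span_superset[of ?E R ?F] by (auto simp: free_module_def)
    ultimately show ?case
      using sub by (metis F.submodule_iff)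
  qed
  from this[of _ n] have "carrier ?F \<subseteq> module_span R ?F ?E"
    by auto
  then show ?thesis
    using sub by (simp add: F.submodule_iff equalityI)
qed

context module
begin

lemma free_lift_linear:
  assumes "m \<in> {..<n} \<rightarrow> carrier M"
  shows "linear_map R (free_module R n) M (free_lift M n m)"
proof -
  interpret F: module R "free_module R n" by (rule module_free_module)
  have v: "v i \<odot>\<^bsub>M\<^esub> m i \<in> carrier M" if "v \<in> carrier (free_module R n)" "i < n" for v i
    using that assms by (auto simp: free_module_def)
  have "free_lift M n m (v \<oplus>\<^bsub>free_module R n\<^esub> w) = free_lift M n m v \<oplus>\<^bsub>M\<^esub> free_lift M n m w"
    if "v \<in> carrier (free_module R n)" "w \<in> carrier (free_module R n)" for v w
  proof -
    have "free_lift M n m (v \<oplus>\<^bsub>free_module R n\<^esub> w) =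
        (\<Oplus>\<^bsub>M\<^esub>i\<in>{..<n}. v i \<odot>\<^bsub>M\<^esub> m i \<oplus>\<^bsub>M\<^esub> w i \<odot>\<^bsub>M\<^esub> m i)"
      unfolding free_lift_def using that assms v
      by (intro M.finsum_cong') (auto simp: free_module_def PiE_iff smult_l_distr Pi_iff)
    then show ?thesis
      using that v by (simp add: free_lift_def Pi_iff)
  qed
  moreover have "free_lift M n m (a \<odot>\<^bsub>free_module R n\<^esub> v) = a \<odot>\<^bsub>M\<^esub> free_lift M n m v"
    if "a \<in> carrier R" "v \<in> carrier (free_module R n)" for a v
  proof -
    have "free_lift M n m (a \<odot>\<^bsub>free_module R n\<^esub> v) = (\<Oplus>\<^bsub>M\<^esub>i\<in>{..<n}. a \<odot>\<^bsub>M\<^esub> (v i \<odot>\<^bsub>M\<^esub> m i))"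
      unfolding free_lift_def using that assms v
      by (intro M.finsum_cong') (auto simp: free_module_def PiE_iff smult_assoc1 Pi_iff)
    then show ?thesis
      using that v by (simp add: free_lift_def finsum_smult_ldistr Pi_iff)
  qed
  moreover have "free_lift M n m v \<in> carrier M" if "v \<in> carrier (free_module R n)" for v
    unfolding free_lift_def using that v by (intro M.finsum_closed) auto
  ultimately show ?thesis
    by (intro linear_mapI F.module_axioms module_axioms)
qed

lemma free_lift_unit:
  assumes "m \<in> {..<n} \<rightarrow> carrier M" "i < n"
  shows "free_lift M n m (free_unit R n i) = m i"
proof -
  have "free_lift M n m (free_unit R n i) = (\<Oplus>\<^bsub>M\<^esub>j\<in>{..<n}. if i = j then m j else \<zero>\<^bsub>M\<^esub>)"
    unfolding free_lift_def using assms
    by (intro M.finsum_cong') (auto simp: free_unit_def Pi_iff)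
  also have "\<dots> = m i"
    using assms by (intro M.finsum_singleton) auto
  finally show ?thesis .
qed

end

text \<open>If \<open>p\<close> and \<open>q\<close> are lifted through each other by \<open>A\<close> and \<open>V\<close>, then any \<open>w\<close> in the kernel of \<open>q\<close>
  is the sum of \<open>w - A (V w)\<close> and \<open>A (V w)\<close>, where \<open>V w\<close> lies in the kernel of \<open>p\<close>.\<close>

lemma fin_gen_kernel_of_lifts:
  assumes p: "linear_map R F M p" and q: "linear_map R G M q"
    and A: "linear_map R F G A" and V: "linear_map R G F V"
    and qA: "\<And>v. v \<in> carrier F \<Longrightarrow> q (A v) = p v"
    and pV: "\<And>w. w \<in> carrier G \<Longrightarrow> p (V w) = q w"
    and S: "finite S" "S \<subseteq> a_kernel F M p" "module_span R F S = a_kernel F M p"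
    and E: "finite E" "E \<subseteq> carrier G" "module_span R G E = carrier G"
  shows "\<exists>T. finite T \<and> T \<subseteq> carrier G \<and> module_span R G T = a_kernel G M q"
proof -
  \<comment> \<open>The first part generates the image under \<open>A\<close> of the kernel of
    \<open>p\<close>, the second the image of the error map \<open>w - A (V w)\<close>.\<close>
  define T where "T = A ` S \<union> (\<lambda>w. w \<ominus>\<^bsub>G\<^esub> A (V w)) ` E"
  interpret p: linear_map R F M p by fact
  interpret q: linear_map R G M q by fact
  interpret A: linear_map R F G A by fact
  interpret V: linear_map R G F V by fact
  have D: "linear_map R G G (\<lambda>w. w \<ominus>\<^bsub>G\<^esub> A (V w))"
    by (intro linear_map_diff linear_map_ident q.M.module_axioms linear_map_comp[OF V A])
  have Sc: "S \<subseteq> carrier F" and S0: "\<And>s. s \<in> S \<Longrightarrow> p s = \<zero>\<^bsub>M\<^esub>"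
    using S(2) by (auto simp: a_kernel_def')
  have "A s \<in> a_kernel G M q" if "s \<in> S" for s
    using that Sc S0 by (auto simp: a_kernel_def' qA)
  moreover have "w \<ominus>\<^bsub>G\<^esub> A (V w) \<in> a_kernel G M q" if "w \<in> E" for w
  proof -
    have "w \<in> carrier G"
      using that E(2) by blast
    then show ?thesis
      by (simp add: a_kernel_def' qA pV p.N.M.r_neg a_minus_def[of M])
  qed
  ultimately have Tk: "T \<subseteq> a_kernel G M q"
    unfolding T_def by blast
  then have Tc: "T \<subseteq> carrier G"
    by (auto simp: a_kernel_def')
  let ?T = "module_span R G T"
  have subT: "submodule ?T R G"
    by (rule q.M.span_submodule[OF Tc])
  have T: "A ` S \<subseteq> ?T" "(\<lambda>w. w \<ominus>\<^bsub>G\<^esub> A (V w)) ` E \<subseteq> ?T"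
    using span_superset[of T R G] unfolding T_def by blast+
  have "a_kernel F M p \<subseteq> {x \<in> carrier F. A x \<in> ?T}"
    unfolding S(3)[symmetric] using Sc T(1)
    by (intro span_least A.vimage_submodule subT) blast
  then have 1: "A v \<in> ?T" if "v \<in> a_kernel F M p" for v
    using that by blast
  have 2: "w \<ominus>\<^bsub>G\<^esub> A (V w) \<in> ?T" if "w \<in> carrier G" for w
    by (rule linear_map.maps_into_submodule[OF D E(3,2) T(2) subT that])
  have "w \<in> ?T" if w: "w \<in> a_kernel G M q" for w
  proof -
    have wc: "w \<in> carrier G" and "V w \<in> a_kernel F M p"
      using w by (simp_all add: a_kernel_def' pV)
    then have "(w \<ominus>\<^bsub>G\<^esub> A (V w)) \<oplus>\<^bsub>G\<^esub> A (V w) \<in> ?T"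
      using 1 2 subT unfolding q.M.submodule_iff by blast
    then show ?thesis
      using wc by (simp add: a_minus_def q.M.M.a_assoc q.M.M.l_neg)
  qed
  then have "?T = a_kernel G M q"
    by (intro equalityI span_least[OF Tk q.kernel_submodule] subsetI)
  moreover have "finite T"
    unfolding T_def using S(1) E(1) by simp
  ultimately show ?thesis
    using Tc by blast
qed

text \<open>Schanuel's argument: one finite presentation of \<open>N\<close> makes the relations
  among any other finite family of generators finitely generated.\<close>

lemma (in module) fin_gen_kernel_free_lift:
  assumes N: "submodule N R M"
    and fp: "fin_presented R (M\<lparr>carrier := N\<rparr>)"
    and m: "m \<in> {..<n} \<rightarrow> carrier M"
    and img: "free_lift M n m ` carrier (free_module R n) = N"
  shows "\<exists>S. finite S \<and> S \<subseteq> carrier (free_module R n) \<and>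
    module_span R (free_module R n) S = a_kernel (free_module R n) M (free_lift M n m)"
proof -
  let ?G = "free_module R n" and ?q = "free_lift M n m"
  obtain k p where "p \<in> module_homs R (free_module R k) (M\<lparr>carrier := N\<rparr>)"
    and pimg: "p ` carrier (free_module R k) = N"
    and pker: "fin_gen R ((free_module R k)\<lparr>carrier := a_kernel (free_module R k) M p\<rparr>)"
    using fp unfolding fin_presented_def a_kernel_restrict by auto
  then have p: "p \<in> module_homs R (free_module R k) M"
    using module_homs_restrict_iff[OF N] by blast
  let ?F = "free_module R k"
  have F: "module R ?F" and G: "module R ?G"
    by (rule module_free_module)+
  have p: "linear_map R ?F M p"
    using p F module_axioms by (intro linear_map.intro linear_map_axioms.intro)
  have q: "linear_map R ?G M ?q"
    using m by (rule free_lift_linear)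
  obtain S where S: "finite S" "S \<subseteq> a_kernel ?F M p" "module_span R ?F S = a_kernel ?F M p"
    using pker unfolding module.fin_gen_submodule_iff[OF F linear_map.kernel_submodule[OF p]]
    by blast
  \<comment> \<open>Both maps have image \<open>N\<close>, so the image of each unit vector on one
    side lifts through the map on the other side.\<close>
  have "\<exists>u\<in>carrier ?G. ?q u = p (free_unit R k i)" for i
    using img pimg by (metis free_unit_closed imageE image_eqI)
  then obtain \<alpha> where \<alpha>: "\<And>i. \<alpha> i \<in> carrier ?G" "\<And>i. ?q (\<alpha> i) = p (free_unit R k i)"
    by metis
  have "\<exists>u\<in>carrier ?F. p u = ?q (free_unit R n i)" for i
    using img pimg by (metis free_unit_closed imageE image_eqI)
  then obtain \<beta> where \<beta>: "\<And>i. \<beta> i \<in> carrier ?F" "\<And>i. p (\<beta> i) = ?q (free_unit R n i)"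
    by metis
  have A: "linear_map R ?F ?G (free_lift ?G k \<alpha>)"
    using \<alpha>(1) by (intro module.free_lift_linear[OF G]) blast
  have V: "linear_map R ?G ?F (free_lift ?F n \<beta>)"
    using \<beta>(1) by (intro module.free_lift_linear[OF F]) blast
  have units: "free_unit R l ` {..<l} \<subseteq> carrier (free_module R l)" for l
    using free_unit_closed by blast
  have qA: "?q (free_lift ?G k \<alpha> v) = p v" if v: "v \<in> carrier ?F" for v
  proof (rule linear_map_eq_on_span[OF linear_map_comp[OF A q] p free_unit_span units _ v])
    fix x assume "x \<in> free_unit R k ` {..<k}"
    then show "?q (free_lift ?G k \<alpha> x) = p x"
      using \<alpha> by (auto simp: module.free_lift_unit[OF G])
  qed
  have pV: "p (free_lift ?F n \<beta> w) = ?q w" if w: "w \<in> carrier ?G" for w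
  proof (rule linear_map_eq_on_span[OF linear_map_comp[OF V p] q free_unit_span units _ w])
    fix x assume "x \<in> free_unit R n ` {..<n}"
    then show "p (free_lift ?F n \<beta> x) = ?q x"
      using \<beta> by (auto simp: module.free_lift_unit[OF F])
  qed
  show ?thesis
    using fin_gen_kernel_of_lifts[OF p q A V qA pV S _ units free_unit_span] by blast
qed


section \<open>Gradings given by projections\<close>

text \<open>Descent on the degree. The base case is every degree below \<open>low\<close>, where a
  filtration bounded below is zero.\<close>

lemma int_induct_from_below:
  fixes d low :: int
  assumes "\<And>d. d < low \<Longrightarrow> P d" "\<And>d. P (d - 1) \<Longrightarrow> P d"
  shows "P d"
proof (cases "d < low")
  case False
  then have "low - 1 \<le> d" by simp
  then show ?thesis
  proof (induction d rule: int_ge_induct)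
    case (step i)
    then show ?case using assms(2)[of "i + 1"] by simp
  qed (simp add: assms(1))
qed (rule assms(1))

text \<open>A grading bounded below is encoded by its family of projections; the homogeneous elements of
  degree \<open>d\<close> are the fixed points of \<open>pr d\<close>.\<close>

locale projections = abelian_group A
  for A (structure) and pr :: "int \<Rightarrow> 'm \<Rightarrow> 'm" and low :: int +
  assumes pr_closed [simp]: "x \<in> carrier A \<Longrightarrow> pr d x \<in> carrier A"
    and pr_add: "x \<in> carrier A \<Longrightarrow> y \<in> carrier A \<Longrightarrow> pr d (x \<oplus> y) = pr d x \<oplus> pr d y"
    and pr_pr: "x \<in> carrier A \<Longrightarrow> pr d (pr e x) = (if d = e then pr e x else \<zero>)"
    and pr_above: "x \<in> carrier A \<Longrightarrow> \<exists>d. \<forall>e>d. pr e x = \<zero>"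
    and pr_below: "x \<in> carrier A \<Longrightarrow> d < low \<Longrightarrow> pr d x = \<zero>"
    and pr_separate: "x \<in> carrier A \<Longrightarrow> (\<And>d. pr d x = \<zero>) \<Longrightarrow> x = \<zero>"
begin

lemma pr_zero [simp]: "pr d \<zero> = \<zero>"
  using pr_add[of \<zero> \<zero> d] by (metis add.r_cancel_one' l_zero pr_closed zero_closed)

lemma pr_minus:
  assumes "x \<in> carrier A" "y \<in> carrier A"
  shows "pr d (x \<ominus> y) = pr d x \<ominus> pr d y"
proof -
  have "pr d (\<ominus> y) = \<ominus> pr d y"
    using assms pr_add[of "\<ominus> y" y d] by (intro minus_equality[symmetric]) (simp_all add: l_neg)
  then show ?thesis
    using assms by (simp add: a_minus_def pr_add)
qed

text \<open>The elements of degree at most \<open>d\<close>. Zero lies in every step of this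
  filtration, so no degree has to be assigned to it.\<close>

definition filt :: "int \<Rightarrow> 'm set"
  where "filt d = {x \<in> carrier A. \<forall>e>d. pr e x = \<zero>}"

lemma filt_carrier: "x \<in> filt d \<Longrightarrow> x \<in> carrier A"
  by (simp add: filt_def)

lemma filt_exists: "x \<in> carrier A \<Longrightarrow> \<exists>d. x \<in> filt d"
  using pr_above by (auto simp: filt_def)

lemma filt_add: "x \<in> filt d \<Longrightarrow> y \<in> filt d \<Longrightarrow> x \<oplus> y \<in> filt d"
  by (simp add: filt_def pr_add)

lemma filt_minus: "x \<in> filt d \<Longrightarrow> y \<in> filt d \<Longrightarrow> x \<ominus> y \<in> filt d"
  by (simp add: filt_def pr_minus) (simp add: a_minus_def)

lemma zero_filt [simp]: "\<zero> \<in> filt d"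
  by (simp add: filt_def)

lemma filt_mono: "x \<in> filt d \<Longrightarrow> d \<le> e \<Longrightarrow> x \<in> filt e"
  by (simp add: filt_def)

lemma pr_filt: "x \<in> carrier A \<Longrightarrow> pr d x \<in> filt d"
  by (simp add: filt_def pr_pr)

lemma minus_pr_filt: "x \<in> filt d \<Longrightarrow> x \<ominus> pr d x \<in> filt (d - 1)"
  by (auto simp: filt_def pr_minus pr_pr) (auto simp: a_minus_def r_neg)

text \<open>Components above \<open>d\<close> vanish by the filtration, those up to \<open>d\<close>
  by the lower bound.\<close>

lemma filt_below: "x \<in> filt d \<Longrightarrow> d < low \<Longrightarrow> x = \<zero>"
  unfolding filt_def by (rule pr_separate) (auto, metis not_le_imp_less order_le_less_trans pr_below)

text \<open>Every element is a finite sum of homogeneous ones. Removing the top component and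
  descending on the degree avoids writing that sum.\<close>

lemma homogeneous_induct [consumes 1, case_names zero add homogeneous]:
  assumes "x \<in> carrier A" "P \<zero>"
    and add: "\<And>x y. x \<in> carrier A \<Longrightarrow> y \<in> carrier A \<Longrightarrow> P x \<Longrightarrow> P y \<Longrightarrow> P (x \<oplus> y)"
    and homogeneous: "\<And>d x. x \<in> carrier A \<Longrightarrow> P (pr d x)"
  shows "P x"
proof -
  have "\<forall>x\<in>filt d. P x" for d
  proof (induction d rule: int_induct_from_below[where low = low])
    case (1 d)
    then show ?case using filt_below \<open>P \<zero>\<close> by blast
  next
    case (2 d)
    show ?case
    proof
      fix x assume x: "x \<in> filt d"
      then have c: "x \<in> carrier A" by (rule filt_carrier)
      have "P ((x \<ominus> pr d x) \<oplus> pr d x)"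
        using 2 minus_pr_filt[OF x] c by (intro add homogeneous) auto
      then show "P x"
        using c by (simp add: diff_add_cancel)
    qed
  qed
  then show ?thesis
    using filt_exists[OF assms(1)] by blast
qed

end

text \<open>The law \<open>pr_smult\<close> is the graded action in terms of components: a
  homogeneous scalar of degree \<open>i\<close> shifts all components by \<open>i\<close>.\<close>

locale projection_module = module R M + R: projections R \<rho> lowR + M: projections M \<pi> lowM
  for R (structure) and \<rho> lowR and M (structure) and \<pi> lowM +
  assumes pr_smult: "a \<in> carrier R \<Longrightarrow> x \<in> carrier M \<Longrightarrow>
    \<pi> d (\<rho> i a \<odot>\<^bsub>M\<^esub> x) = \<rho> i a \<odot>\<^bsub>M\<^esub> \<pi> (d - i) x"
begin

lemma smult_filt:
  "a \<in> carrier R \<Longrightarrow> x \<in> M.filt d \<Longrightarrow> \<rho> i a \<odot>\<^bsub>M\<^esub> x \<in> M.filt (i + d)"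
  by (auto simp: M.filt_def pr_smult)

text \<open>Every scalar is a sum of homogeneous ones, so closure under homogeneous scalars and
  addition suffices.\<close>

lemma graded_submoduleI:
  assumes sub: "P \<subseteq> carrier M" and zero: "\<zero>\<^bsub>M\<^esub> \<in> P"
    and add: "\<And>x y. x \<in> P \<Longrightarrow> y \<in> P \<Longrightarrow> x \<oplus>\<^bsub>M\<^esub> y \<in> P"
    and smult: "\<And>a i x. a \<in> carrier R \<Longrightarrow> x \<in> P \<Longrightarrow> \<rho> i a \<odot>\<^bsub>M\<^esub> x \<in> P"
  shows "submodule P R M"
proof -
  have "a \<odot>\<^bsub>M\<^esub> x \<in> P" if "a \<in> carrier R" and x: "x \<in> P" for a x
    using that(1)
  proof (induction a rule: R.homogeneous_induct)
    case (add a b)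
    then show ?case
      using x sub by (simp add: smult_l_distr subsetD assms(3))
  qed (use x sub zero smult in auto)
  then show ?thesis
    using sub zero add by (simp add: submodule_iff)
qed

end


section \<open>Lifting generators and relations from initial terms\<close>

text \<open>\<open>G\<close> is free on the Groebner basis, \<open>\<phi>\<close> maps its generators to the basis elements and \<open>\<psi>\<close> maps them
  to the initial terms, so that \<open>\<phi>\<close> and \<open>\<psi>\<close> agree up to lower-degree terms.\<close>

locale groebner_lifting =
  G: projection_module R \<rho> lowR G \<gamma> lowG + M: projection_module R \<rho> lowR M \<pi> lowM +
  phi: linear_map R G M \<phi> + psi: linear_map R G M \<psi>
  for R (structure) and \<rho> lowR and G and \<gamma> lowG and M and \<pi> lowM and \<phi> \<psi> +
  fixes E N
  assumes E_carrier: "E \<subseteq> carrier G" and E_span: "module_span R G E = carrier G"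
    and E_degree: "e \<in> E \<Longrightarrow>
      \<exists>d. \<gamma> d e = e \<and> \<pi> d (\<psi> e) = \<psi> e \<and> \<phi> e \<ominus>\<^bsub>M\<^esub> \<psi> e \<in> M.M.filt (d - 1)"
    and N: "submodule N R M" and E_image: "\<phi> ` E \<subseteq> N"
    and initial: "x \<in> N \<Longrightarrow> x \<in> M.M.filt d \<Longrightarrow> \<pi> d x \<in> \<psi> ` carrier G"
begin

section \<open>Behaviour of the two maps with respect to degree\<close>

lemma phi_N: "v \<in> carrier G \<Longrightarrow> \<phi> v \<in> N"
  using phi.maps_into_submodule[OF E_span E_carrier E_image N] .

text \<open>On generators this holds because \<open>\<psi>\<close> sends each one to a homogeneous
  element of the same degree; the elements satisfying it form a submodule.\<close>

lemma psi_graded: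
  assumes "v \<in> carrier G"
  shows "\<pi> d (\<psi> v) = \<psi> (\<gamma> d v)"
proof -
  let ?P = "{v \<in> carrier G. \<forall>d. \<pi> d (\<psi> v) = \<psi> (\<gamma> d v)}"
  have "submodule ?P R G"
    by (rule G.graded_submoduleI) (auto simp: G.M.pr_add M.M.pr_add G.pr_smult M.pr_smult)
  moreover have "e \<in> ?P" if eE: "e \<in> E" for e
  proof -
    obtain k where k: "\<gamma> k e = e" "\<pi> k (\<psi> e) = \<psi> e"
      using E_degree[OF eE] by blast
    have e: "e \<in> carrier G"
      using eE E_carrier by blast
    \<comment> \<open>For \<open>d\<close> different from \<open>k\<close> both sides
      vanish.\<close>
    have "\<pi> d (\<psi> e) = \<psi> (\<gamma> d e)" for d
      using M.M.pr_pr[of "\<psi> e" d k] G.M.pr_pr[OF e, of d k] k e by auto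
    then show ?thesis
      using e by simp
  qed
  ultimately have "module_span R G E \<subseteq> ?P"
    by (intro span_least) auto
  then show ?thesis
    using assms E_span by blast
qed

text \<open>The error term: \<open>\<phi>\<close> is the degree-preserving map \<open>\<psi>\<close>
  plus \<open>\<theta>\<close>, which lowers degrees by at least one.\<close>

definition \<theta> where "\<theta> v = \<phi> v \<ominus>\<^bsub>M\<^esub> \<psi> v"

lemma theta_linear: "linear_map R G M \<theta>"
  unfolding \<theta>_def
  by (rule linear_map_diff[OF phi.linear_map_axioms psi.linear_map_axioms])

sublocale theta: linear_map R G M \<theta>
  by (rule theta_linear)

lemma theta_homogeneous:
  assumes "v \<in> carrier G"
  shows "\<theta> (\<gamma> d v) \<in> M.M.filt (d - 1)"
proof -
  let ?P = "{v \<in> carrier G. \<forall>d. \<theta> (\<gamma> d v) \<in> M.M.filt (d - 1)}"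
  have "submodule ?P R G"
  proof (rule G.graded_submoduleI)
    fix a i x assume a: "a \<in> carrier R" and x: "x \<in> ?P"
    have "\<theta> (\<gamma> d (\<rho> i a \<odot>\<^bsub>G\<^esub> x)) \<in> M.M.filt (d - 1)" for d
      using a x M.smult_filt[of a "\<theta> (\<gamma> (d - i) x)" "d - i - 1" i]
      by (simp add: G.pr_smult)
    then show "\<rho> i a \<odot>\<^bsub>G\<^esub> x \<in> ?P"
      using a x by simp
  qed (auto simp: G.M.pr_add M.M.filt_add)
  moreover have "e \<in> ?P" if eE: "e \<in> E" for e
  proof -
    obtain k where k: "\<gamma> k e = e" "\<theta> e \<in> M.M.filt (k - 1)"
      using E_degree[OF eE] unfolding \<theta>_def by blast
    have e: "e \<in> carrier G"
      using eE E_carrier by blast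
    have "\<theta> (\<gamma> d e) \<in> M.M.filt (d - 1)" for d
      using G.M.pr_pr[OF e, of d k] k by (cases "d = k") auto
    then show ?thesis
      using e by simp
  qed
  ultimately have "module_span R G E \<subseteq> ?P"
    by (intro span_least) auto
  then show ?thesis
    using assms E_span by blast
qed

text \<open>Without its top component, \<open>v\<close> has degree at most \<open>d - 1\<close> and
  its image has degree at most \<open>d - 2\<close> by induction; \<open>theta_homogeneous\<close>
  covers the top component.\<close>

lemma theta_filt: "v \<in> G.M.filt d \<Longrightarrow> \<theta> v \<in> M.M.filt (d - 1)"
proof (induction d arbitrary: v rule: int_induct_from_below[where low = lowG])
  case (1 d)
  then show ?case
    using G.M.filt_below by fastforce
next
  case (2 d)
  have v: "v \<in> carrier G"
    using "2.prems" by (rule G.M.filt_carrier)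
  have "\<theta> (v \<ominus>\<^bsub>G\<^esub> \<gamma> d v) \<in> M.M.filt (d - 1)"
    using "2.IH"[OF G.M.minus_pr_filt[OF "2.prems"]] by (rule M.M.filt_mono) simp
  then have "\<theta> (v \<ominus>\<^bsub>G\<^esub> \<gamma> d v) \<oplus>\<^bsub>M\<^esub> \<theta> (\<gamma> d v) \<in> M.M.filt (d - 1)"
    using theta_homogeneous[OF v] by (rule M.M.filt_add)
  then show ?case
    using v by (simp add: M.M.diff_add_cancel)
qed

text \<open>The division algorithm: the top component of \<open>x\<close> is hit by
  \<open>\<psi>\<close>, and subtracting the value of \<open>\<phi>\<close> at the same element
  lowers the degree. The degree bound on the preimage \<open>w\<close> is what later makes relations
  lift modulo lower degree.\<close>

lemma phi_lift:
  assumes "x \<in> N" "x \<in> M.M.filt d"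
  shows "\<exists>w\<in>G.M.filt d. \<phi> w = x"
  using assms
proof (induction d arbitrary: x rule: int_induct_from_below[where low = lowM])
  case (1 d)
  then have "x = \<zero>\<^bsub>M\<^esub>"
    using M.M.filt_below by blast
  then show ?case
    by (intro bexI[of _ "\<zero>\<^bsub>G\<^esub>"]) simp_all
next
  case (2 d)
  have x: "x \<in> carrier M"
    using "2.prems"(2) by (rule M.M.filt_carrier)
  obtain u where u: "u \<in> carrier G" "\<pi> d x = \<psi> u"
    using initial[OF "2.prems"] by blast
  \<comment> \<open>The preimage \<open>u\<close> need not be homogeneous. Its component of degree
    \<open>d\<close> has the same image, since \<open>\<psi>\<close> preserves degrees and the
    target is homogeneous of degree \<open>d\<close>.\<close>
  have px: "\<pi> d x = \<psi> (\<gamma> d u)"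
    using u x psi_graded[OF u(1), of d] M.M.pr_pr[OF x, of d d] by simp
  have "x \<ominus>\<^bsub>M\<^esub> \<phi> (\<gamma> d u) = (x \<ominus>\<^bsub>M\<^esub> \<psi> (\<gamma> d u)) \<ominus>\<^bsub>M\<^esub> \<theta> (\<gamma> d u)"
    using x u M.M.diff_add_diff[of "x \<ominus>\<^bsub>M\<^esub> \<psi> (\<gamma> d u)" "\<psi> (\<gamma> d u)" "\<theta> (\<gamma> d u)" "\<psi> (\<gamma> d u)"]
    by (simp add: M.M.diff_add_cancel \<theta>_def) (simp add: M.M.diff_self M.M.diff_zero)
  also have "\<dots> \<in> M.M.filt (d - 1)"
    using M.M.minus_pr_filt[OF "2.prems"(2)] theta_homogeneous[OF u(1)]
    unfolding px by (rule M.M.filt_minus)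
  finally obtain w where w: "w \<in> G.M.filt (d - 1)" "\<phi> w = x \<ominus>\<^bsub>M\<^esub> \<phi> (\<gamma> d u)"
    using "2.IH" M.submodule_minus[OF N "2.prems"(1) phi_N] u(1) G.M.pr_closed by blast
  have "w \<oplus>\<^bsub>G\<^esub> \<gamma> d u \<in> G.M.filt d"
    using G.M.filt_mono[OF w(1), of d] G.M.pr_filt[OF u(1)] by (intro G.M.filt_add) simp_all
  moreover have "\<phi> (w \<oplus>\<^bsub>G\<^esub> \<gamma> d u) = x"
    using w u x G.M.filt_carrier[OF w(1)] by (simp add: M.M.diff_add_cancel)
  ultimately show ?case
    by blast
qed

lemma phi_image: "\<phi> ` carrier G = N"
proof (intro equalityI subsetI)
  fix x assume x: "x \<in> N"
  then have "x \<in> carrier M"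
    using N unfolding M.submodule_iff by blast
  then obtain d where "x \<in> M.M.filt d"
    using M.M.filt_exists by blast
  then show "x \<in> \<phi> ` carrier G"
    using phi_lift[OF x] G.M.filt_carrier by blast
qed (use phi_N in auto)

text \<open>From \<open>\<phi> t = 0\<close> the values of \<open>\<psi>\<close> and
  \<open>\<theta>\<close> at \<open>t\<close> are opposite, and the latter has no component in
  degree \<open>d\<close>.\<close>

lemma psi_kernel_of_phi_kernel:
  assumes "t \<in> a_kernel G M \<phi>" "t \<in> G.M.filt d"
  shows "\<gamma> d t \<in> a_kernel G M \<psi>"
proof -
  have t: "t \<in> carrier G" "\<phi> t = \<zero>\<^bsub>M\<^esub>"
    using assms(1) by (simp_all add: a_kernel_def')
  have "\<zero>\<^bsub>M\<^esub> \<ominus>\<^bsub>M\<^esub> \<psi> (\<gamma> d t) = \<pi> d (\<theta> t)"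
    using t M.M.pr_minus[of "\<zero>\<^bsub>M\<^esub>" "\<psi> t" d] psi_graded[OF t(1), of d] by (simp add: \<theta>_def)
  also have "\<dots> = \<zero>\<^bsub>M\<^esub>"
    using theta_filt[OF assms(2)] by (simp add: M.M.filt_def)
  finally have "\<zero>\<^bsub>M\<^esub> = \<psi> (\<gamma> d t)"
    by (rule M.M.eq_of_diff_eq_zero) (simp_all add: t(1))
  then show ?thesis
    using t by (simp add: a_kernel_def')
qed

text \<open>The homogeneous components of the generators in \<open>S\<close> are relations among the
  initial terms. Each is corrected by an element of lower degree to a relation among the basis
  elements, and these corrected relations generate by descent on the degree.\<close>

lemma fin_gen_phi_kernel:
  assumes S: "finite S" "S \<subseteq> carrier G" "module_span R G S = a_kernel G M \<psi>"
  shows "\<exists>T. finite T \<and> T \<subseteq> a_kernel G M \<phi> \<and> module_span R G T = a_kernel G M \<phi>"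
proof -
  let ?D = "\<lambda>s. {d. \<gamma> d s \<noteq> \<zero>\<^bsub>G\<^esub>}"
  have S0: "\<psi> s = \<zero>\<^bsub>M\<^esub>" if "s \<in> S" for s
    using that span_superset[of S R G] S(3) by (auto simp: a_kernel_def')
  \<comment> \<open>Since \<open>\<psi>\<close> kills the component of \<open>s\<close>, its value
    under \<open>\<phi>\<close> is that of \<open>\<theta>\<close> and so has degree below
    \<open>d\<close>; division then yields a correction \<open>c\<close> of degree below
    \<open>d\<close>.\<close>
  have "\<exists>c\<in>G.M.filt (d - 1). \<phi> c = \<phi> (\<gamma> d s)" if "s \<in> S" for s d
  proof (rule phi_lift)
    have s: "s \<in> carrier G"
      using that S(2) by blast
    then show "\<phi> (\<gamma> d s) \<in> N"
      by (intro phi_N) simp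
    have "\<psi> (\<gamma> d s) = \<zero>\<^bsub>M\<^esub>"
      using psi_graded[OF s, of d] S0[OF that] by simp
    then show "\<phi> (\<gamma> d s) \<in> M.M.filt (d - 1)"
      using theta_homogeneous[OF s, of d] s by (simp add: \<theta>_def M.M.diff_zero)
  qed
  then obtain c where c: "\<And>s d. s \<in> S \<Longrightarrow> c s d \<in> G.M.filt (d - 1)"
    "\<And>s d. s \<in> S \<Longrightarrow> \<phi> (c s d) = \<phi> (\<gamma> d s)"
    by metis
  \<comment> \<open>Only nonzero components are lifted, so each \<open>s\<close> contributes
    finitely many relations.\<close>
  define T where "T = (\<Union>s\<in>S. (\<lambda>d. \<gamma> d s \<ominus>\<^bsub>G\<^esub> c s d) ` ?D s)"
  have "finite T"
    unfolding T_def
  proof (intro finite_UN_I finite_imageI S(1))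
    fix s assume "s \<in> S"
    then have s: "s \<in> carrier G"
      using S(2) by blast
    obtain k where "s \<in> G.M.filt k"
      using G.M.filt_exists[OF s] by blast
    then have "?D s \<subseteq> {lowG..k}"
      using G.M.pr_below[OF s] by (force simp: G.M.filt_def not_less[symmetric])
    then show "finite (?D s)"
      using finite_subset by blast
  qed
  have T: "\<gamma> d s \<ominus>\<^bsub>G\<^esub> c s d \<in> a_kernel G M \<phi>" if "s \<in> S" for s d
  proof -
    have "s \<in> carrier G" "c s d \<in> carrier G"
      using that S(2) c(1) G.M.filt_carrier by blast+
    then show ?thesis
      using c(2)[OF that] by (simp add: a_kernel_def' M.M.diff_self)
  qed
  then have Tk: "T \<subseteq> a_kernel G M \<phi>"
    unfolding T_def by blast
  let ?K = "module_span R G T"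
  have "T \<subseteq> carrier G"
    using Tk by (auto simp: a_kernel_def')
  then have K: "submodule ?K R G"
    by (rule G.span_submodule)
  have Kk: "?K \<subseteq> a_kernel G M \<phi>"
    using Tk phi.kernel_submodule by (rule span_least)
  \<comment> \<open>Those \<open>u\<close> each of whose components agrees, modulo lower degree,
    with an element of \<open>?K\<close> of no larger degree. It is a submodule containing
    \<open>S\<close>, hence contains the kernel of \<open>\<psi>\<close>.\<close>
  let ?U = "{u \<in> carrier G. \<forall>d. \<exists>y\<in>?K \<inter> G.M.filt d. \<gamma> d u \<ominus>\<^bsub>G\<^esub> y \<in> G.M.filt (d - 1)}"
  have "submodule ?U R G"
  proof (rule G.graded_submoduleI)
    show "\<zero>\<^bsub>G\<^esub> \<in> ?U"
      using K by (auto simp: G.submodule_iff G.M.diff_zero intro!: bexI[of _ "\<zero>\<^bsub>G\<^esub>"])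
  next
    fix u v assume u: "u \<in> ?U" and v: "v \<in> ?U"
    have "\<exists>y\<in>?K \<inter> G.M.filt d. \<gamma> d (u \<oplus>\<^bsub>G\<^esub> v) \<ominus>\<^bsub>G\<^esub> y \<in> G.M.filt (d - 1)" for d
    proof -
      obtain y z where y: "y \<in> ?K" "y \<in> G.M.filt d" "\<gamma> d u \<ominus>\<^bsub>G\<^esub> y \<in> G.M.filt (d - 1)"
        and z: "z \<in> ?K" "z \<in> G.M.filt d" "\<gamma> d v \<ominus>\<^bsub>G\<^esub> z \<in> G.M.filt (d - 1)"
        using u v by blast
      have "\<gamma> d (u \<oplus>\<^bsub>G\<^esub> v) \<ominus>\<^bsub>G\<^esub> (y \<oplus>\<^bsub>G\<^esub> z) = (\<gamma> d u \<ominus>\<^bsub>G\<^esub> y) \<oplus>\<^bsub>G\<^esub> (\<gamma> d v \<ominus>\<^bsub>G\<^esub> z)"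
        using u v G.M.filt_carrier[OF y(2)] G.M.filt_carrier[OF z(2)]
        by (simp add: G.M.pr_add G.M.diff_add_diff)
      also have "\<dots> \<in> G.M.filt (d - 1)"
        using y z by (intro G.M.filt_add)
      finally show ?thesis
        using y z K G.M.filt_add[OF y(2) z(2)] unfolding G.submodule_iff by blast
    qed
    then show "u \<oplus>\<^bsub>G\<^esub> v \<in> ?U"
      using u v by simp
  next
    fix a i u assume a: "a \<in> carrier R" and u: "u \<in> ?U"
    have "\<exists>y\<in>?K \<inter> G.M.filt d. \<gamma> d (\<rho> i a \<odot>\<^bsub>G\<^esub> u) \<ominus>\<^bsub>G\<^esub> y \<in> G.M.filt (d - 1)" for d
    proof -
      obtain y where y: "y \<in> ?K" "y \<in> G.M.filt (d - i)"
          "\<gamma> (d - i) u \<ominus>\<^bsub>G\<^esub> y \<in> G.M.filt (d - i - 1)"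
        using u by blast
      have "\<gamma> d (\<rho> i a \<odot>\<^bsub>G\<^esub> u) \<ominus>\<^bsub>G\<^esub> \<rho> i a \<odot>\<^bsub>G\<^esub> y = \<rho> i a \<odot>\<^bsub>G\<^esub> (\<gamma> (d - i) u \<ominus>\<^bsub>G\<^esub> y)"
        using a u G.M.filt_carrier[OF y(2)] by (simp add: G.pr_smult G.smult_diff)
      also have "\<dots> \<in> G.M.filt (d - 1)"
        using G.smult_filt[OF a y(3), of i] by simp
      finally have "\<gamma> d (\<rho> i a \<odot>\<^bsub>G\<^esub> u) \<ominus>\<^bsub>G\<^esub> \<rho> i a \<odot>\<^bsub>G\<^esub> y \<in> G.M.filt (d - 1)" .
      moreover have "\<rho> i a \<odot>\<^bsub>G\<^esub> y \<in> ?K"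
        using K a y(1) G.R.pr_closed unfolding G.submodule_iff by blast
      moreover have "\<rho> i a \<odot>\<^bsub>G\<^esub> y \<in> G.M.filt d"
        using G.smult_filt[OF a y(2), of i] by simp
      ultimately show ?thesis
        by blast
    qed
    then show "\<rho> i a \<odot>\<^bsub>G\<^esub> u \<in> ?U"
      using a u by simp
  qed auto
  moreover have "S \<subseteq> ?U"
  proof
    fix s assume sS: "s \<in> S"
    then have s: "s \<in> carrier G"
      using S(2) by blast
    have "\<exists>y\<in>?K \<inter> G.M.filt d. \<gamma> d s \<ominus>\<^bsub>G\<^esub> y \<in> G.M.filt (d - 1)" for d
    proof (cases "\<gamma> d s = \<zero>\<^bsub>G\<^esub>")
      case True
      then show ?thesis
        using K by (intro bexI[of _ "\<zero>\<^bsub>G\<^esub>"]) (auto simp: G.submodule_iff G.M.diff_zero)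
    next
      case False
      \<comment> \<open>The lifted relation differs from the component of \<open>s\<close> exactly
        by the correction \<open>c s d\<close>.\<close>
      let ?y = "\<gamma> d s \<ominus>\<^bsub>G\<^esub> c s d"
      have "?y \<in> T"
        unfolding T_def using sS False by blast
      then have "?y \<in> ?K"
        using span_superset[of T R G] by blast
      moreover have "?y \<in> G.M.filt d"
        using G.M.pr_filt[OF s] G.M.filt_mono[OF c(1)[OF sS], of d d]
        by (intro G.M.filt_minus) simp_all
      moreover have "\<gamma> d s \<ominus>\<^bsub>G\<^esub> ?y = c s d"
        using s G.M.filt_carrier[OF c(1)[OF sS]]
        by (simp add: a_minus_def G.M.minus_add G.M.a_assoc[symmetric] G.M.r_neg)
      ultimately show ?thesis
        using c(1)[OF sS] by (intro bexI[of _ ?y]) simp_all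
    qed
    then show "s \<in> ?U"
      using s by simp
  qed
  ultimately have U: "a_kernel G M \<psi> \<subseteq> ?U"
    using span_least[of S ?U R G] S(3) by simp
  have "t \<in> ?K" if "t \<in> a_kernel G M \<phi>" "t \<in> G.M.filt d" for t d
    using that
  proof (induction d arbitrary: t rule: int_induct_from_below[where low = lowG])
    case (1 d)
    then have "t = \<zero>\<^bsub>G\<^esub>"
      using G.M.filt_below by blast
    then show ?case
      using K by (simp add: G.submodule_iff)
  next
    case (2 d)
    have t: "t \<in> carrier G"
      using "2.prems"(2) by (rule G.M.filt_carrier)
    \<comment> \<open>The top component of \<open>t\<close> is a relation among initial terms. An
      element \<open>y\<close> of \<open>?K\<close> therefore cancels it modulo lower degree, and
      \<open>t - y\<close> is again in the kernel of \<open>\<phi>\<close>.\<close>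
    have "\<gamma> d t \<in> ?U"
      using U psi_kernel_of_phi_kernel[OF "2.prems"] by blast
    then obtain y where y: "y \<in> ?K" "y \<in> G.M.filt d" "\<gamma> d (\<gamma> d t) \<ominus>\<^bsub>G\<^esub> y \<in> G.M.filt (d - 1)"
      by blast
    have yc: "y \<in> carrier G"
      using y(2) by (rule G.M.filt_carrier)
    have "(t \<ominus>\<^bsub>G\<^esub> \<gamma> d t) \<oplus>\<^bsub>G\<^esub> (\<gamma> d t \<ominus>\<^bsub>G\<^esub> y) \<in> G.M.filt (d - 1)"
      using G.M.minus_pr_filt[OF "2.prems"(2)] y(3) t
      by (intro G.M.filt_add) (simp_all add: G.M.pr_pr)
    also have "(t \<ominus>\<^bsub>G\<^esub> \<gamma> d t) \<oplus>\<^bsub>G\<^esub> (\<gamma> d t \<ominus>\<^bsub>G\<^esub> y) = t \<ominus>\<^bsub>G\<^esub> y"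
      using t yc by (simp add: a_minus_def G.M.a_assoc[symmetric])
        (simp add: G.M.a_assoc G.M.l_neg)
    finally have "t \<ominus>\<^bsub>G\<^esub> y \<in> ?K"
      using "2.IH" G.submodule_minus[OF phi.kernel_submodule "2.prems"(1)] y(1) Kk by blast
    then have "(t \<ominus>\<^bsub>G\<^esub> y) \<oplus>\<^bsub>G\<^esub> y \<in> ?K"
      using y(1) K unfolding G.submodule_iff by blast
    then show ?case
      using t yc by (simp add: G.M.diff_add_cancel)
  qed
  then have "a_kernel G M \<phi> \<subseteq> ?K"
    using G.M.filt_exists by (force simp: a_kernel_def')
  then show ?thesis
    using \<open>finite T\<close> Tk Kk by blast
qed

end


section \<open>Projections of graded rings and modules\<close>

text \<open>An additive map taking degree \<open>e\<close> to degree \<open>i + e\<close> is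
  determined by homogeneous arguments. Taking for \<open>f\<close> the multiplication by a
  homogeneous scalar gives both \<open>pr_mult\<close> and \<open>pr_smult\<close>.\<close>

lemma (in projections) pr_shift:
  assumes closed: "\<And>x. x \<in> carrier A \<Longrightarrow> f x \<in> carrier A"
    and add: "\<And>x y. x \<in> carrier A \<Longrightarrow> y \<in> carrier A \<Longrightarrow> f (x \<oplus> y) = f x \<oplus> f y"
    and shift: "\<And>e x. x \<in> carrier A \<Longrightarrow> pr (i + e) (f (pr e x)) = f (pr e x)"
    and x: "x \<in> carrier A"
  shows "pr d (f x) = f (pr (d - i) x)"
proof -
  have f0: "f \<zero> = \<zero>"
    using add[of \<zero> \<zero>] closed[of \<zero>] by (metis add.r_cancel_one' l_zero zero_closed)
  show ?thesis
    using x
  proof (induction x rule: homogeneous_induct)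
    case zero
    show ?case by (simp add: f0)
  next
    case (add x y)
    then show ?case by (simp add: assms(2) closed pr_add)
  next
    case (homogeneous e x)
    have "pr d (f (pr e x)) = (if d = i + e then f (pr e x) else \<zero>)"
      using pr_pr[of "f (pr e x)" d "i + e"] homogeneous closed shift[OF homogeneous] by simp
    also have "\<dots> = f (pr (d - i) (pr e x))"
      using homogeneous by (auto simp: pr_pr f0)
    finally show ?case .
  qed
qed

section \<open>Components in an internal direct sum\<close>

locale internally_graded = abelian_group A
  for A (structure) and G :: "int \<Rightarrow> 'm set" +
  assumes A_grading: "grading A G"
begin

lemma G_carrier: "x \<in> G n \<Longrightarrow> x \<in> carrier A"
  and G_zero: "\<zero> \<in> G n"
  and G_add: "x \<in> G n \<Longrightarrow> y \<in> G n \<Longrightarrow> x \<oplus> y \<in> G n"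
proof -
  interpret subgroup "G n" "add_monoid A"
    using A_grading by (simp add: grading_def)
  show "x \<in> G n \<Longrightarrow> x \<in> carrier A" "\<zero> \<in> G n"
    and "x \<in> G n \<Longrightarrow> y \<in> G n \<Longrightarrow> x \<oplus> y \<in> G n"
    using subset one_closed m_closed by auto
qed

lemma component_decomp: "x \<in> carrier A \<Longrightarrow> is_decomp A G x (component A G x)"
  unfolding component_def
  by (rule theI'[of "is_decomp A G x"]) (use A_grading in \<open>simp add: grading_def\<close>)

text \<open>The index set may be any finite set containing the support, which leaves room for
  cancellation in sums.\<close>

lemma component_eqI:
  assumes f: "\<And>n. f n \<in> G n" and S: "finite S" "\<And>n. n \<notin> S \<Longrightarrow> f n = \<zero>"
    and x: "x = finsum A f S"
  shows "component A G x = f"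
proof -
  have fc: "f \<in> S \<rightarrow> carrier A"
    using f G_carrier by blast
  have sub: "{n. f n \<noteq> \<zero>} \<subseteq> S"
    using S(2) by blast
  have "finsum A f S = finsum A f {n. f n \<noteq> \<zero>}"
    using fc sub S(1) by (intro add.finprod_mono_neutral_cong_right) auto
  then have "is_decomp A G x f"
    using f x finite_subset[OF sub S(1)] by (simp add: is_decomp_def)
  moreover have "x \<in> carrier A"
    using x fc by (simp add: finsum_closed)
  then have "\<exists>!f. is_decomp A G x f"
    using A_grading by (simp add: grading_def)
  ultimately show ?thesis
    unfolding component_def by (rule the1_equality[rotated])
qed

lemma component_mem: "x \<in> carrier A \<Longrightarrow> component A G x n \<in> G n"
  using component_decomp by (simp add: is_decomp_def)

lemma component_finite: "x \<in> carrier A \<Longrightarrow> finite {n. component A G x n \<noteq> \<zero>}"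
  using component_decomp by (simp add: is_decomp_def)

lemma component_homogeneous:
  assumes "x \<in> G d"
  shows "component A G x n = (if n = d then x else \<zero>)"
proof -
  have "component A G x = (\<lambda>n. if n = d then x else \<zero>)"
    using assms G_zero G_carrier by (intro component_eqI[where S = "{d}"]) auto
  then show ?thesis
    by simp
qed

lemma component_add:
  assumes x: "x \<in> carrier A" and y: "y \<in> carrier A"
  shows "component A G (x \<oplus> y) n = component A G x n \<oplus> component A G y n"
proof -
  let ?f = "component A G x" and ?g = "component A G y"
  let ?S = "{n. ?f n \<noteq> \<zero>} \<union> {n. ?g n \<noteq> \<zero>}"
  have S: "finite ?S"
    using component_finite x y by blast
  have fc: "?f \<in> T \<rightarrow> carrier A" and gc: "?g \<in> T \<rightarrow> carrier A" for T
    using component_mem G_carrier x y by blast+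
  have "x = finsum A ?f {n. ?f n \<noteq> \<zero>}" "y = finsum A ?g {n. ?g n \<noteq> \<zero>}"
    using component_decomp x y by (simp_all add: is_decomp_def)
  moreover have "finsum A ?f {n. ?f n \<noteq> \<zero>} = finsum A ?f ?S"
    using fc S by (intro add.finprod_mono_neutral_cong_left) auto
  moreover have "finsum A ?g {n. ?g n \<noteq> \<zero>} = finsum A ?g ?S"
    using gc S by (intro add.finprod_mono_neutral_cong_left) auto
  ultimately have "x \<oplus> y = finsum A (\<lambda>n. ?f n \<oplus> ?g n) ?S"
    using finsum_addf[OF fc gc, of ?S] by simp
  then have "component A G (x \<oplus> y) = (\<lambda>n. ?f n \<oplus> ?g n)"
    using x y by (intro component_eqI[OF _ S]) (auto intro: G_add component_mem)
  then show ?thesis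
    by simp
qed

lemma projections_component:
  assumes "\<And>n. n < low \<Longrightarrow> G n = {\<zero>}"
  shows "projections A (\<lambda>n x. component A G x n) low"
proof (unfold_locales, goal_cases)
  case (1 x d)
  then show ?case using component_mem G_carrier by blast
next
  case (2 x y d)
  then show ?case by (rule component_add)
next
  case (3 x d e)
  then show ?case using component_homogeneous[OF component_mem[of x e]] by simp
next
  case (4 x)
  let ?S = "{n. component A G x n \<noteq> \<zero>}"
  \<comment> \<open>For an empty support the value of \<open>Max\<close> is irrelevant, as the bound
    holds vacuously.\<close>
  have "\<forall>n\<in>?S. n \<le> Max ?S"
    using component_finite[OF 4] by simp
  then show ?case
    by (intro exI[of _ "Max ?S"]) force
next
  case (5 x d)
  then show ?case using component_mem[of x d] assms[of d] by simp
next
  case (6 x)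
  then show ?case
    using component_decomp[of x] by (simp add: is_decomp_def)
qed

end

section \<open>Gradings of free modules\<close>

locale projection_ring = cring R + projections R \<rho> low
  for R (structure) and \<rho> low +
  assumes pr_mult: "a \<in> carrier R \<Longrightarrow> b \<in> carrier R \<Longrightarrow> \<rho> d (\<rho> i a \<otimes> b) = \<rho> i a \<otimes> \<rho> (d - i) b"
begin

text \<open>Comparing components in \<open>x = x \<otimes> \<one>\<close> shows that the degree-zero part of \<open>\<one>\<close> is also a unit element.\<close>

lemma pr_one: "\<rho> 0 \<one> = \<one>"
proof -
  have "x \<otimes> \<rho> 0 \<one> = x" if "x \<in> carrier R" for x
    using that
  proof (induction x rule: homogeneous_induct)
    case (homogeneous d x)
    then show ?case
      using pr_mult[of x \<one> d d] by (simp add: pr_pr)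
  qed (simp_all add: l_distr)
  from this[of \<one>] show ?thesis
    by simp
qed

text \<open>Generator \<open>j\<close> is placed in degree \<open>\<delta> j\<close>, so degree
  \<open>d\<close> of the module corresponds to ring degree \<open>d - \<delta> j\<close> in
  coordinate \<open>j\<close>.\<close>

definition free_pr :: "nat \<Rightarrow> (nat \<Rightarrow> int) \<Rightarrow> int \<Rightarrow> (nat \<Rightarrow> 'a) \<Rightarrow> nat \<Rightarrow> 'a"
  where "free_pr n \<delta> d v = (\<lambda>j\<in>{..<n}. \<rho> (d - \<delta> j) (v j))"

lemma projection_module_free:
  assumes m: "\<And>j. j < n \<Longrightarrow> m \<le> \<delta> j"
  shows "projection_module R \<rho> low (free_module R n) (free_pr n \<delta>) (low + m)"
proof -
  interpret F: module R "free_module R n"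
    by (rule module_free_module)
  have mem: "v j \<in> carrier R" if "v \<in> {..<n} \<rightarrow>\<^sub>E carrier R" "j < n" for v j
    using that by auto
  show ?thesis
  proof (unfold_locales, unfold free_module_simps free_pr_def, goal_cases)
    case (1 v d)
    then show ?case by (auto simp: mem)
  next
    case (2 v w d)
    then show ?case by (intro restrict_ext) (simp add: mem pr_add)
  next
    case (3 v d e)
    have "(\<lambda>j\<in>{..<n}. \<rho> (d - \<delta> j) ((\<lambda>j\<in>{..<n}. \<rho> (e - \<delta> j) (v j)) j)) =
        (\<lambda>j\<in>{..<n}. if d = e then \<rho> (e - \<delta> j) (v j) else \<zero>)"
      using 3 by (intro restrict_ext) (simp add: mem pr_pr)
    then show ?case by simp
  next
    case (4 v)
    then have "\<forall>j\<in>{..<n}. \<exists>k. \<forall>e>k. \<rho> e (v j) = \<zero>"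
      using pr_above mem by blast
    then obtain k where k: "\<And>j e. j < n \<Longrightarrow> e > k j \<Longrightarrow> \<rho> e (v j) = \<zero>"
      by (metis lessThan_iff)
    \<comment> \<open>Inserting \<open>0\<close> keeps the set nonempty for
      \<open>n = 0\<close>.\<close>
    let ?K = "Max (insert 0 ((\<lambda>j. k j + \<delta> j) ` {..<n}))"
    have "k j + \<delta> j \<le> ?K" if "j < n" for j
      using that by (intro Max_ge) auto
    then have "\<rho> (e - \<delta> j) (v j) = \<zero>" if "j < n" "e > ?K" for j e
      using that by (intro k) force+
    then show ?case
      by (intro exI[of _ ?K] allI impI restrict_ext) simp
  next
    case (5 v d)
    then show ?case
      using m by (intro restrict_ext pr_below mem) force+
  next
    case (6 v)
    have *: "\<rho> d (v j) = \<zero>" if "j < n" for j d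
      using fun_cong[OF 6(2)[of "d + \<delta> j"], of j] that by simp
    have "v j = \<zero>" if "j < n" for j
      by (rule pr_separate) (simp_all add: * that mem[OF 6(1)])
    then have "(\<lambda>j\<in>{..<n}. v j) = (\<lambda>j\<in>{..<n}. \<zero>)"
      by (intro restrict_ext) simp
    then show ?case
      using 6(1) by (simp add: PiE_iff extensional_restrict)
  next
    case (7 a v d i)
    then show ?case
      by (intro restrict_ext) (simp add: mem pr_mult algebra_simps)
  qed
qed

text \<open>The only nontrivial coordinate is \<open>\<one>\<close>, which is homogeneous of degree
  zero by \<open>pr_one\<close>.\<close>

lemma free_pr_unit: "j < n \<Longrightarrow> free_pr n \<delta> (\<delta> j) (free_unit R n j) = free_unit R n j"
  unfolding free_pr_def free_unit_def by (intro restrict_ext) (simp add: pr_one)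

end

section \<open>Components of graded rings and modules as projections\<close>

context graded_module
begin

sublocale RG: internally_graded R RG
  using ring_grading by unfold_locales

sublocale MG: internally_graded M MG
  using module_grading by unfold_locales

lemma projection_ring_component:
  assumes "\<And>n. n < low \<Longrightarrow> RG n = {\<zero>}"
  shows "projection_ring R (\<lambda>n a. component R RG a n) low"
proof -
  interpret P: projections R "\<lambda>n a. component R RG a n" low
    using assms by (rule RG.projections_component)
  show ?thesis
  proof
    fix a b d i assume a: "a \<in> carrier R" and b: "b \<in> carrier R"
    let ?f = "\<lambda>b. component R RG a i \<otimes> b"
    show "component R RG (?f b) d = ?f (component R RG b (d - i))"
    proof (rule P.pr_shift[OF _ _ _ b])
      fix e x assume "x \<in> carrier R"
      then have "?f (component R RG x e) \<in> RG (i + e)"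
        using a by (intro graded_mult RG.component_mem)
      then show "component R RG (?f (component R RG x e)) (i + e) = ?f (component R RG x e)"
        by (simp add: RG.component_homogeneous)
    qed (use a P.pr_closed in \<open>auto simp: r_distr\<close>)
  qed
qed

lemma projection_module_component:
  assumes "\<And>n. n < lowR \<Longrightarrow> RG n = {\<zero>}" "\<And>n. n < lowM \<Longrightarrow> MG n = {\<zero>\<^bsub>M\<^esub>}"
  shows "projection_module R (\<lambda>n a. component R RG a n) lowR M (\<lambda>n x. component M MG x n) lowM"
proof -
  interpret P: projections R "\<lambda>n a. component R RG a n" lowR
    using assms(1) by (rule RG.projections_component)
  interpret Q: projections M "\<lambda>n x. component M MG x n" lowM
    using assms(2) by (rule MG.projections_component)
  show ?thesis
  proof
    fix a x d i assume a: "a \<in> carrier R" and x: "x \<in> carrier M"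
    let ?f = "\<lambda>x. component R RG a i \<odot>\<^bsub>M\<^esub> x"
    show "component M MG (?f x) d = ?f (component M MG x (d - i))"
    proof (rule Q.pr_shift[OF _ _ _ x])
      fix e y assume "y \<in> carrier M"
      then have "?f (component M MG y e) \<in> MG (i + e)"
        using a by (intro graded_smult RG.component_mem MG.component_mem)
      then show "component M MG (?f (component M MG y e)) (i + e) = ?f (component M MG y e)"
        by (simp add: MG.component_homogeneous)
    qed (use a P.pr_closed in \<open>auto simp: smult_r_distr\<close>)
  qed
qed

lemma deg_of_eqI:
  assumes "x \<in> carrier M" "component M MG x d \<noteq> \<zero>\<^bsub>M\<^esub>" "\<And>e. e > d \<Longrightarrow> component M MG x e = \<zero>\<^bsub>M\<^esub>"
  shows "deg_of M MG x = d"
  unfolding deg_of_def using assms MG.component_finite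
  by (intro Max_eqI) (auto simp: not_less[symmetric])

lemma component_above_deg:
  assumes "x \<in> carrier M" "e > deg_of M MG x"
  shows "component M MG x e = \<zero>\<^bsub>M\<^esub>"
  using assms Max_ge[OF MG.component_finite[OF assms(1)], of e]
  unfolding deg_of_def by fastforce

end

section \<open>Coherence\<close>

lemma (in graded_module) fin_presented_submodule:
  assumes RG: "\<And>n. n < 0 \<Longrightarrow> RG n = {\<zero>}" and coh: "groebner_coherent R M MG"
    and N: "submodule N R M" and fg: "fin_gen R (M\<lparr>carrier := N\<rparr>)"
  shows "fin_presented R (M\<lparr>carrier := N\<rparr>)"
proof -
  obtain lowM where lowM: "\<And>n. n < lowM \<Longrightarrow> MG n = {\<zero>\<^bsub>M\<^esub>}"
    using bounded_below by blast
  let ?\<rho> = "\<lambda>n a. component R RG a n" and ?\<pi> = "\<lambda>n x. component M MG x n"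
  \<comment> \<open>The support of the ring in non-negative degrees gives the bound
    \<open>0\<close>, from which the free module inherits a lower bound for its degrees.\<close>
  interpret R: projection_ring R ?\<rho> 0
    using RG by (rule projection_ring_component)
  interpret PM: projection_module R ?\<rho> 0 M ?\<pi> lowM
    using RG lowM by (rule projection_module_component)
  obtain B where B: "finite B" "B \<subseteq> N"
    and gb: "module_span R M (initial_term M MG ` B) = initial_submodule R M MG N"
    using coh N fg unfolding groebner_coherent_def groebner_basis_def by blast
  have Nc: "N \<subseteq> carrier M"
    using N by (simp add: submodule_iff)
  \<comment> \<open>Zero is discarded so that every \<open>b j\<close> has a genuine degree and a
    nonzero initial term.\<close>
  obtain b n where b: "bij_betw b {..<n::nat} (B - {\<zero>\<^bsub>M\<^esub>})"
    using ex_bij_betw_nat_finite[of "B - {\<zero>\<^bsub>M\<^esub>}"] B(1) by (auto simp: lessThan_atLeast0)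
  then have bimg: "b ` {..<n} = B - {\<zero>\<^bsub>M\<^esub>}"
    by (simp add: bij_betw_def)
  then have bN: "b j \<in> N" and bM: "b j \<in> carrier M" and b0: "b j \<noteq> \<zero>\<^bsub>M\<^esub>" if "j < n" for j
    using B(2) Nc that by blast+
  define \<delta> where "\<delta> j = deg_of M MG (b j)" for j
  define g where "g j = initial_term M MG (b j)" for j
  have g: "g j = ?\<pi> (\<delta> j) (b j)" if "j < n" for j
    using b0[OF that] by (simp add: g_def \<delta>_def initial_term_def)
  then have gM: "g j \<in> carrier M" if "j < n" for j
    using PM.M.pr_closed[OF bM[OF that]] that by simp
  let ?G = "free_module R n" and ?E = "free_unit R n ` {..<n}"
  let ?\<phi> = "free_lift M n b" and ?\<psi> = "free_lift M n g"
  \<comment> \<open>A lower bound for the degrees of the generators, with \<open>0\<close> inserted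
    to cover an empty basis.\<close>
  let ?m = "Min (insert 0 (\<delta> ` {..<n}))"
  interpret G: projection_module R ?\<rho> 0 ?G "R.free_pr n \<delta>" "0 + ?m"
    by (rule R.projection_module_free) simp
  interpret phi: linear_map R ?G M ?\<phi>
    using bM by (intro free_lift_linear) auto
  interpret psi: linear_map R ?G M ?\<psi>
    using gM by (intro free_lift_linear) auto
  have Ec: "?E \<subseteq> carrier ?G"
    using free_unit_closed by blast
  let ?I = "initial_submodule R M MG N"
  \<comment> \<open>Discarding zero from \<open>B\<close> does not change the span, because its
    initial term is zero.\<close>
  have gI: "module_span R M (g ` {..<n}) = ?I"
  proof -
    have sub: "submodule (module_span R M (g ` {..<n})) R M"
      using gM by (intro span_submodule) blast
    have gimg: "g ` {..<n} = initial_term M MG ` (B - {\<zero>\<^bsub>M\<^esub>})"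
      unfolding bimg[symmetric] g_def by (simp add: image_image)
    have "initial_term M MG x \<in> module_span R M (g ` {..<n})" if "x \<in> B" for x
    proof (cases "x = \<zero>\<^bsub>M\<^esub>")
      case True
      then show ?thesis
        using sub by (simp add: initial_term_def submodule_iff)
    next
      case False
      then show ?thesis
        using that span_superset[of "g ` {..<n}" R M] unfolding gimg by blast
    qed
    then have "module_span R M (initial_term M MG ` B) \<subseteq> module_span R M (g ` {..<n})"
      by (intro span_least sub) blast
    moreover have "module_span R M (g ` {..<n}) \<subseteq> module_span R M (initial_term M MG ` B)"
      unfolding gimg module_span_def by (intro hull_mono) blast
    ultimately show ?thesis
      using gb by simp
  qed
  have "?\<psi> ` ?E = g ` {..<n}"
    using free_lift_unit[of g n] gM by (force simp: image_image)
  then have psi_img: "?\<psi> ` carrier ?G = ?I"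
    using psi.image_span[OF free_unit_span Ec] gI by simp
  interpret L: groebner_lifting R ?\<rho> 0 ?G "R.free_pr n \<delta>" "0 + ?m" M ?\<pi> lowM ?\<phi> ?\<psi> ?E N
  proof (intro groebner_lifting.intro groebner_lifting_axioms.intro G.projection_module_axioms
      PM.projection_module_axioms phi.linear_map_axioms psi.linear_map_axioms N Ec free_unit_span)
    show "?\<phi> ` ?E \<subseteq> N"
      using free_lift_unit[of b n] bM bN by auto
  next
    fix e assume "e \<in> ?E"
    then obtain j where j: "j < n" "e = free_unit R n j"
      by blast
    have e: "?\<phi> e = b j" "?\<psi> e = g j"
      using j bM gM by (simp_all add: free_lift_unit)
    have "b j \<in> PM.M.filt (\<delta> j)"
      using component_above_deg[OF bM] bM j by (simp add: PM.M.filt_def \<delta>_def)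
    then have "b j \<ominus>\<^bsub>M\<^esub> g j \<in> PM.M.filt (\<delta> j - 1)"
      using PM.M.minus_pr_filt g j by simp
    moreover have "?\<pi> (\<delta> j) (g j) = g j"
      using PM.M.pr_pr[OF bM, of j "\<delta> j" "\<delta> j"] g j by simp
    moreover have "R.free_pr n \<delta> (\<delta> j) e = e"
      using j R.free_pr_unit by simp
    ultimately show "\<exists>d. R.free_pr n \<delta> d e = e \<and> ?\<pi> d (?\<psi> e) = ?\<psi> e \<and>
        ?\<phi> e \<ominus>\<^bsub>M\<^esub> ?\<psi> e \<in> PM.M.filt (d - 1)"
      unfolding e by blast
  next
    fix x d assume x: "x \<in> N" "x \<in> PM.M.filt d"
    \<comment> \<open>The bound \<open>d\<close> may exceed the degree of \<open>x\<close>, and then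
      the component is zero; otherwise it is the initial term of \<open>x\<close>.\<close>
    show "?\<pi> d x \<in> ?\<psi> ` carrier ?G"
    proof (cases "?\<pi> d x = \<zero>\<^bsub>M\<^esub>")
      case True
      then show ?thesis
        using psi.image_submodule by (simp add: submodule_iff)
    next
      case False
      then have "x \<noteq> \<zero>\<^bsub>M\<^esub>"
        using PM.M.pr_zero by metis
      moreover have "deg_of M MG x = d"
        using x(1) Nc x(2) False by (intro deg_of_eqI) (auto simp: PM.M.filt_def)
      ultimately have "initial_term M MG x = ?\<pi> d x"
        by (simp add: initial_term_def)
      then have "?\<pi> d x \<in> initial_term M MG ` (N - {\<zero>\<^bsub>M\<^esub>})"
        using x(1) \<open>x \<noteq> \<zero>\<^bsub>M\<^esub>\<close> by force
      then show ?thesis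
        unfolding psi_img initial_submodule_def by (rule subsetD[OF span_superset])
    qed
  qed
  have I: "submodule ?I R M"
    using psi.image_submodule psi_img by simp
  \<comment> \<open>The initial submodule is the image of the degree-preserving map
    \<open>?\<psi>\<close>, hence closed under components.\<close>
  have "homogeneous_submodule R M MG ?I"
    unfolding homogeneous_submodule_def
  proof (intro conjI I ballI allI)
    fix x d assume "x \<in> ?I"
    then obtain v where v: "v \<in> carrier ?G" "x = ?\<psi> v"
      unfolding psi_img[symmetric] by blast
    then show "?\<pi> d x \<in> ?I"
      unfolding psi_img[symmetric] using L.psi_graded[OF v(1), of d] G.M.pr_closed[OF v(1)]
      by simp
  qed
  moreover have "fin_gen R (M\<lparr>carrier := ?I\<rparr>)"
    unfolding fin_gen_submodule_iff[OF I]
    using gI span_superset[of "g ` {..<n}" R M] by (intro exI[of _ "g ` {..<n}"]) simp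
  ultimately have "fin_presented R (M\<lparr>carrier := ?I\<rparr>)"
    using coh unfolding groebner_coherent_def graded_coherent_def by blast
  \<comment> \<open>Graded coherence supplies some finite presentation of the initial submodule;
    this transfers it to the generators \<open>g\<close>.\<close>
  from fin_gen_kernel_free_lift[OF I this _ psi_img] gM
  obtain S where "finite S" "S \<subseteq> carrier ?G" "module_span R ?G S = a_kernel ?G M ?\<psi>"
    by blast
  then have "fin_gen R (?G\<lparr>carrier := a_kernel ?G M ?\<phi>\<rparr>)"
    unfolding G.fin_gen_submodule_iff[OF phi.kernel_submodule] by (rule L.fin_gen_phi_kernel)
  moreover have "?\<phi> \<in> module_homs R ?G (M\<lparr>carrier := N\<rparr>)"
    using phi.module_hom L.phi_image by (simp add: module_homs_restrict_iff[OF N])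
  ultimately show ?thesis
    unfolding fin_presented_def a_kernel_restrict using L.phi_image
    by (intro exI[of _ n] bexI[of _ ?\<phi>]) simp_all
qed

theorem proposition4p4:
  fixes R :: "('r, 'a) ring_scheme" and RG :: "int \<Rightarrow> 'r set"
    and M :: "('r, 'm, 'b) module_scheme" and MG :: "int \<Rightarrow> 'm set"
  assumes "graded_ring R RG"
    and "\<And>n. n < 0 \<Longrightarrow> RG n = {\<zero>\<^bsub>R\<^esub>}"
    and "graded_module R RG M MG"
    and "groebner_coherent R M MG"
  shows "coherent_module R M"
proof -
  have "fin_gen R M"
    using assms(4) by (simp add: groebner_coherent_def graded_coherent_def)
  then show ?thesis
    unfolding coherent_module_def
    using graded_module.fin_presented_submodule[OF assms(3,2,4)] by blast
qed

end
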